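(* Let $n$ be a non-negative integer. 1. Let $S(z)$ be a (scalar) rational inner function of degree $n$. Then $S(z)$ can be represented in the form $$S(z)=A+zB(I_n-zD)^{-1}C,$$ where $A,B,C,D$ are the blocks of some minimal unitary matrix $U=\begin{bmatrix}A&B\\ C&D\end{bmatrix}\in\mathfrak{M}_{(n+1)\times(n+1)}$. 2. Let $U=\begin{bmatrix}A&B\\ C&D\end{bmatrix}\in\mathfrak{M}_{(n+1)\times(n+1)}$ be a unitary matrix and let $S(z)=A+zB(I_n-zD)^{-1}C$. Then $S(z)$ is a rational inner function with $\deg S\le n$. If the matrix $U$ is minimal, then $\deg S=n$. 3. Let $U'=\begin{bmatrix}A'&B'\\ C'&D'\end{bmatrix}$ and $U''=\begin{bmatrix}A''&B''\\ C''&D''\end{bmatrix}$ be unitary matrices in $\mathfrak{M}_{(n+1)\times(n+1)}$ and let $$S'(z)=A'+zB'(I_n-zD')^{-1}C',\qquad S''(z)=A''+zB''(I_n-zD'')^{-1}C''.$$ If the matrices $U'$ and $U''$ are equivalent, then $S'(z)\equiv S''(z)$. If $S'(z)\equiv S''(z)$ and the matrices $U'$ and $U''$ are minimal, then $U'$ and $U''$ are equivalent.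
   Context: $\mathfrak{M}_{p\times q}$ is the set of complex $p\times q$ matrices. All $(n+1)\times(n+1)$ matrices $U$ are partitioned as $U=\begin{bmatrix}A&B\\ C&D\end{bmatrix}$ with $A\in\mathfrak{M}_{1\times1}$, $B\in\mathfrak{M}_{1\times n}$, $C\in\mathfrak{M}_{n\times1}$, $D\in\mathfrak{M}_{n\times n}$ (for $n=0$ only the block $A$ is present). A scalar rational inner function is a rational function $S$, holomorphic in $\mathbb{D}=\{|z|<1\}$, with $|S(z)|\le1$ for $z\in\mathbb{D}$ and $|S(t)|=1$ for $|t|=1$. Its degree is the maximum of the degrees of numerator and denominator in lowest terms. A unitary matrix $U\in\mathfrak{M}_{(n+1)\times(n+1)}$ is controllable if the $n\times n$ matrix $[C\ \ DC\ \cdots\ D^{n-1}C]$ has rank $n$, observable if the $n\times n$ matrix $[B^*\ \ D^*B^*\ \cdots\ (D^* )^{n-1}B^*]$ has rank $n$, and minimal if it is both controllable and observable. Two unitary matrices $U',U''\in\mathfrak{M}_{(n+1)\times(n+1)}$ are equivalent if there is a unitary matrix $V\in\mathfrak{M}_{n\times n}$ with $$\begin{bmatrix}1&0\\0&V\end{bmatrix}U''=U'\begin{bmatrix}1&0\\0&V\end{bmatrix}.$$ *)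

theory Defs
  imports
    "HOL-Analysis.Complex_Analysis_Basics"
    "HOL-Computational_Algebra.Polynomial_Factorial"
    "HOL-Computational_Algebra.Field_as_Ring"
    "Jordan_Normal_Form.Schur_Decomposition"
    "Jordan_Normal_Form.DL_Rank"
begin

section \<open>Rational functions\<close>

text \<open>
  A rational function is an element of the field of fractions of the polynomial ring, so identities
  between rational functions are identities in that field, not identities on a chosen domain.
\<close>

type_synonym ratfun = "complex poly fract"

definition rat_const :: "complex \<Rightarrow> ratfun" where
  "rat_const c = to_fract [:c:]"

definition rat_var :: ratfun where
  "rat_var = to_fract [:0, 1:]"

text \<open>
  \<^const>\<open>quot_of_fract\<close> returns numerator and denominator in lowest terms. At a pole
  the division is by zero and the value is \<open>0\<close>; near a pole the values are unbounded.
\<close>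

definition rat_eval :: "ratfun \<Rightarrow> complex \<Rightarrow> complex" where
  "rat_eval S z = (case quot_of_fract S of (p, q) \<Rightarrow> poly p z / poly q z)"

definition rat_degree :: "ratfun \<Rightarrow> nat" where
  "rat_degree S = (case quot_of_fract S of (p, q) \<Rightarrow> max (degree p) (degree q))"

text \<open>
  The value \<open>0\<close> at poles does no harm here: at a pole in the disc \<^term>\<open>rat_eval S\<close> is
  discontinuous, hence not holomorphic, and at a pole on the circle its modulus is not \<open>1\<close>.
\<close>

definition rational_inner :: "ratfun \<Rightarrow> bool" where
  "rational_inner S \<longleftrightarrow>
     rat_eval S holomorphic_on ball 0 1 \<and>
     (\<forall>z \<in> ball 0 1. cmod (rat_eval S z) \<le> 1) \<and>
     (\<forall>t. cmod t = 1 \<longrightarrow> cmod (rat_eval S t) = 1)"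


section \<open>Unitary matrices\<close>

definition unitary_mat :: "nat \<Rightarrow> complex mat \<Rightarrow> bool" where
  "unitary_mat m U \<longleftrightarrow>
     U \<in> carrier_mat m m \<and> mat_adjoint U * U = 1\<^sub>m m \<and> U * mat_adjoint U = 1\<^sub>m m"

text \<open>
  The blocks of an \<open>(n+1) \<times> (n+1)\<close> matrix are those of \<^term>\<open>split_block U 1 1\<close>, of sizes
  \<open>1 \<times> 1\<close>, \<open>1 \<times> n\<close>, \<open>n \<times> 1\<close> and \<open>n \<times> n\<close>. For \<open>n = 0\<close> the last three are empty.
\<close>

definition krylov_mat :: "nat \<Rightarrow> complex mat \<Rightarrow> complex mat \<Rightarrow> complex mat" where
  \<comment> \<open>\<open>[C  DC  \<dots>  D^(n-1) C]\<close> for a column \<open>C\<close>\<close>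
  "krylov_mat n D C = mat_of_cols n (map (\<lambda>k. col (D ^\<^sub>m k * C) 0) [0..<n])"

definition controllable :: "nat \<Rightarrow> complex mat \<Rightarrow> bool" where
  "controllable n U \<longleftrightarrow>
     (case split_block U 1 1 of (A, B, C, D) \<Rightarrow> vec_space.rank n (krylov_mat n D C) = n)"

definition observable :: "nat \<Rightarrow> complex mat \<Rightarrow> bool" where
  "observable n U \<longleftrightarrow>
     (case split_block U 1 1 of (A, B, C, D) \<Rightarrow>
        vec_space.rank n (krylov_mat n (mat_adjoint D) (mat_adjoint B)) = n)"

definition minimal_mat :: "nat \<Rightarrow> complex mat \<Rightarrow> bool" where
  "minimal_mat n U \<longleftrightarrow> controllable n U \<and> observable n U"

definition equivalent_mat :: "nat \<Rightarrow> complex mat \<Rightarrow> complex mat \<Rightarrow> bool" where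
  "equivalent_mat n U' U'' \<longleftrightarrow>
     (\<exists>V. unitary_mat n V \<and>
        (let W = four_block_mat (1\<^sub>m 1) (0\<^sub>m 1 n) (0\<^sub>m n 1) V in W * U'' = U' * W))"


section \<open>Transfer functions\<close>

text \<open>
  \<open>A + z B (I - z D)\<^sup>-\<^sup>1 C\<close> as a matrix expression over the field of rational functions, read off as
  the only entry of a \<open>1 \<times> 1\<close> matrix. The determinant of \<open>I - z D\<close> is a polynomial with value \<open>1\<close>
  at \<open>0\<close>, so the inverse exists in that field.
\<close>

definition transfer_fun :: "nat \<Rightarrow> complex mat \<Rightarrow> ratfun" where
  "transfer_fun n U =
     (case split_block (map_mat rat_const U) 1 1 of (A, B, C, D) \<Rightarrow>
        (A + rat_var \<cdot>\<^sub>m (B * the (mat_inverse (1\<^sub>m n - rat_var \<cdot>\<^sub>m D)) * C)) $$ (0, 0))"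

section \<open>Values of the transfer function\<close>

text \<open>
  The expression over the field of rational functions has the expected complex values: \<open>rat_eval_transfer_fun\<close>
  below shows that they are given by the same formula wherever \<open>I - z D\<close> is invertible over the
  complex numbers. If \<open>I - z D\<close> is singular at some point of the unit circle, the rational function
  may still have a value there, the singularity of the formula being removable.
\<close>

lemma hom_adj_mat:
  assumes h: "comm_ring_hom h" and M: "M \<in> carrier_mat n n"
  shows "adj_mat (map_mat h M) = map_mat h (adj_mat M)"
proof -
  interpret comm_ring_hom h by fact
  have *: "mat_delete (map_mat h M) i j = map_mat h (mat_delete M i j)" if "i < n" "j < n" for i j
    using M that by (intro eq_matI) (auto simp: mat_delete_def)
  show ?thesis
    using M by (intro eq_matI) (auto simp: adj_mat_def cofactor_def * hom_distribs)
qed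

lemma the_mat_inverse:
  fixes M :: "'a :: field mat"
  assumes M: "M \<in> carrier_mat n n" and d: "Determinant.det M \<noteq> 0"
  shows "the (mat_inverse M) = (1 / Determinant.det M) \<cdot>\<^sub>m adj_mat M"
proof -
  let ?N = "(1 / Determinant.det M) \<cdot>\<^sub>m adj_mat M"
  note adj = adj_mat[OF M]
  have N: "?N \<in> carrier_mat n n" using adj by simp
  have r: "M * ?N = 1\<^sub>m n"
    using adj M d by (simp add: mult_smult_distrib[of _ n n]) (intro eq_matI, auto)
  have l: "?N * M = 1\<^sub>m n"
    using adj M d by (simp add: mult_smult_assoc_mat[of _ n n]) (intro eq_matI, auto)
  have "M \<in> Units (ring_mat TYPE('a) n ())"
    using M N r l unfolding Units_def ring_mat_def by auto
  then obtain X where X: "mat_inverse M = Some X"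
    using mat_inverse(1)[OF M, of "()"] by fastforce
  have "X = ?N"
  proof -
    have "X * M = 1\<^sub>m n" "X \<in> carrier_mat n n" using mat_inverse(2)[OF M X] by auto
    hence "X = X * (M * ?N)" "X * (M * ?N) = ?N"
      using r N M assoc_mult_mat[of X n n M n ?N n] by auto
    thus ?thesis by simp
  qed
  with X show ?thesis by simp
qed

definition transfer_num :: "'a :: comm_ring_1 mat \<Rightarrow> 'a mat \<Rightarrow> 'a mat \<Rightarrow> 'a mat \<Rightarrow> 'a \<Rightarrow> 'a" where
  "transfer_num A B C M x = Determinant.det M * A $$ (0,0) + x * (B * adj_mat M * C) $$ (0,0)"

lemma hom_transfer_num:
  assumes h: "comm_ring_hom h"
    and c: "A \<in> carrier_mat 1 1" "B \<in> carrier_mat 1 n" "C \<in> carrier_mat n 1" "M \<in> carrier_mat n n"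
  shows "transfer_num (map_mat h A) (map_mat h B) (map_mat h C) (map_mat h M) (h x) = h (transfer_num A B C M x)"
proof -
  interpret comm_ring_hom h by fact
  note a = adj_mat(1)[OF c(4)]
  have "map_mat h B * map_mat h (adj_mat M) * map_mat h C = map_mat h (B * adj_mat M * C)"
    using mat_hom_mult[OF c(2) a] mat_hom_mult[OF mult_carrier_mat[OF c(2) a] c(3)] by simp
  moreover have "B * adj_mat M * C \<in> carrier_mat 1 1" using c a by auto
  ultimately show ?thesis using c by (simp add: transfer_num_def hom_adj_mat[OF h] hom_distribs)
qed

lemma transfer_entry:
  fixes M :: "'a :: field mat"
  assumes c: "A \<in> carrier_mat 1 1" "B \<in> carrier_mat 1 n" "C \<in> carrier_mat n 1" "M \<in> carrier_mat n n"
    and d: "Determinant.det M \<noteq> 0"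
  shows "(A + x \<cdot>\<^sub>m (B * the (mat_inverse M) * C)) $$ (0, 0) = transfer_num A B C M x / Determinant.det M"
proof -
  note a = adj_mat(1)[OF c(4)]
  have "B * the (mat_inverse M) * C = (1 / Determinant.det M) \<cdot>\<^sub>m (B * adj_mat M * C)"
    unfolding the_mat_inverse[OF c(4) d] using c a
    by (simp add: mult_smult_distrib[of _ 1 n _ n] mult_smult_assoc_mat[of _ 1 n _ 1])
  moreover have "B * adj_mat M * C \<in> carrier_mat 1 1" using c a by auto
  ultimately show ?thesis using c d by (simp add: transfer_num_def add_divide_distrib)
qed

lemma rat_eval_Fract:
  assumes "poly q z \<noteq> 0"
  shows "rat_eval (Fract p q) z = poly p z / poly q z"
proof -
  obtain a b where ab: "quot_of_fract (Fract p q) = (a, b)" by force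
  have q: "q \<noteq> 0" using assms by auto
  have b: "b \<noteq> 0" "coprime a b"
    using ab snd_quot_of_fract_nonzero[of "Fract p q"] coprime_quot_of_fract[of "Fract p q"] by auto
  have "Fract a b = Fract p q" using ab Fract_quot_of_fract[of "Fract p q"] by simp
  hence eq: "a * q = p * b" using q b by (simp add: eq_fract)
  have "b dvd q" using eq b(2) by (metis coprime_commute coprime_dvd_mult_right_iff dvd_triv_right)
  hence "poly b z \<noteq> 0" using assms by (auto elim!: dvdE)
  moreover have "poly a z * poly q z = poly p z * poly b z" using arg_cong[OF eq, of "\<lambda>r. poly r z"] by simp
  ultimately show ?thesis using assms ab by (simp add: rat_eval_def frac_eq_eq)
qed

lemma comm_ring_hom_to_fract: "comm_ring_hom (to_fract :: 'a :: idom \<Rightarrow> _)"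
  by unfold_locales auto

lemma comm_ring_hom_poly: "comm_ring_hom (\<lambda>p :: complex poly. poly p z)"
  by unfold_locales auto

lemma rat_eval_transfer_fun:
  assumes U: "U \<in> carrier_mat (n + 1) (n + 1)" and s: "split_block U 1 1 = (A, B, C, D)"
    and d: "Determinant.det (1\<^sub>m n - z \<cdot>\<^sub>m D) \<noteq> 0"
  shows "rat_eval (transfer_fun n U) z =
    (A + z \<cdot>\<^sub>m (B * the (mat_inverse (1\<^sub>m n - z \<cdot>\<^sub>m D)) * C)) $$ (0, 0)"
proof -
  have c: "A \<in> carrier_mat 1 1" "B \<in> carrier_mat 1 n" "C \<in> carrier_mat n 1" "D \<in> carrier_mat n n"
    using split_block[OF s, of n n] U by auto
  define k where "k = (\<lambda>c::complex. [:c:])"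
  define P where "P = 1\<^sub>m n - [:0,1:] \<cdot>\<^sub>m map_mat k D"
  have P: "P \<in> carrier_mat n n" using c by (auto simp: P_def)
  have kc: "map_mat k A \<in> carrier_mat 1 1" "map_mat k B \<in> carrier_mat 1 n" "map_mat k C \<in> carrier_mat n 1"
    using c by auto
  have ev: "map_mat (\<lambda>p. poly p z) (map_mat k X) = X" for X
    by (intro eq_matI) (auto simp: k_def)
  have tf: "map_mat to_fract (map_mat k X) = map_mat rat_const X" for X
    by (intro eq_matI) (auto simp: k_def rat_const_def)
  have Pz: "map_mat (\<lambda>p. poly p z) P = 1\<^sub>m n - z \<cdot>\<^sub>m D"
    using c by (intro eq_matI) (auto simp: P_def k_def)
  have Pf: "map_mat to_fract P = 1\<^sub>m n - rat_var \<cdot>\<^sub>m map_mat rat_const D"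
    using c by (intro eq_matI) (auto simp: P_def k_def rat_const_def rat_var_def simp flip: to_fract_mult)
  let ?p = "transfer_num (map_mat k A) (map_mat k B) (map_mat k C) P [:0,1:]"
  have dz: "Determinant.det (1\<^sub>m n - z \<cdot>\<^sub>m D) = poly (Determinant.det P) z"
    using comm_ring_hom.hom_det[OF comm_ring_hom_poly[of z], of P] unfolding Pz .
  have df: "Determinant.det (map_mat to_fract P) = to_fract (Determinant.det P)"
    by (rule comm_ring_hom.hom_det[OF comm_ring_hom_to_fract])
  have P0: "Determinant.det P \<noteq> 0" using d dz by auto
  have sf: "split_block (map_mat rat_const U) 1 1 =
     (map_mat rat_const A, map_mat rat_const B, map_mat rat_const C, map_mat rat_const D)"
    using s U unfolding split_block_def Let_def by (auto intro!: eq_matI)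
  have "transfer_fun n U = to_fract ?p / to_fract (Determinant.det P)"
  proof -
    have 1: "transfer_num (map_mat rat_const A) (map_mat rat_const B) (map_mat rat_const C) (map_mat to_fract P) rat_var
      = to_fract ?p"
      using hom_transfer_num[OF comm_ring_hom_to_fract kc P, of "[:0,1:]"] by (simp add: tf rat_var_def)
    show ?thesis unfolding transfer_fun_def sf prod.case Pf[symmetric]
      using transfer_entry[of "map_mat rat_const A" "map_mat rat_const B" n "map_mat rat_const C" "map_mat to_fract P" rat_var]
        c P P0 1 df by auto
  qed
  also have "\<dots> = Fract ?p (Determinant.det P)" by (simp add: Fract_conv_to_fract)
  also have "rat_eval \<dots> z = poly ?p z / poly (Determinant.det P) z"
    using d dz by (intro rat_eval_Fract) auto
  also have "poly ?p z = transfer_num A B C (1\<^sub>m n - z \<cdot>\<^sub>m D) z"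
    using hom_transfer_num[OF comm_ring_hom_poly[of z] kc P, of "[:0,1:]"] by (simp add: ev Pz)
  also have "\<dots> / poly (Determinant.det P) z =
     (A + z \<cdot>\<^sub>m (B * the (mat_inverse (1\<^sub>m n - z \<cdot>\<^sub>m D)) * C)) $$ (0, 0)"
    using transfer_entry[of A B n C "1\<^sub>m n - z \<cdot>\<^sub>m D" z] c(1-3)
      minus_carrier_mat[OF smult_carrier_mat[OF c(4)]] d dz by metis
  finally show ?thesis .
qed

end

theory Submission
  imports Defs "HOL-Complex_Analysis.Conformal_Mappings" "HOL-Computational_Algebra.Polynomial_FPS"
begin

text \<open>
  Everything is expressed through polynomial solutions of one linear system. For a polynomial \<open>p\<close>,
  consider polynomials \<open>y\<^sub>0, \<dots>, y\<^sub>n\<close> with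
  \<open>(y\<^sub>0, y\<^sub>1, \<dots>, y\<^sub>n) = U (p, z y\<^sub>1, \<dots>, z y\<^sub>n)\<close> (\<open>realizes\<close> below). Eliminating
  \<open>y\<^sub>1, \<dots>, y\<^sub>n\<close> shows that \<open>y\<^sub>0 / p\<close> is the transfer function of \<open>U\<close>; the adjugate of \<open>I - z D\<close>
  gives a solution with \<open>p = det (I - z D)\<close> and all degrees at most \<open>n\<close>
  (\<open>realization_of_transfer_fun\<close>). The Taylor coefficients of the transfer function at \<open>0\<close> are
  \<open>s\<^sub>0 = A\<close> and \<open>s\<^sub>k\<^sub>+\<^sub>1 = B D^k C\<close>.

  The transfer function is inner because \<open>U\<close> preserves norms:
  \<open>|p|\<^sup>2 - |y\<^sub>0|\<^sup>2 = (1 - |z|\<^sup>2) (|y\<^sub>1|\<^sup>2 + \<dots> + |y\<^sub>n|\<^sup>2)\<close> at every point \<open>z\<close> (\<open>realizes_unitary\<close>).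
  Common zeros of \<open>y\<^sub>0\<close> and \<open>p\<close> are removed by continuity.

  Minimality and degree are linked by the Hankel matrix \<open>H = (s\<^sub>i\<^sub>+\<^sub>j\<^sub>+\<^sub>1)\<close>, \<open>0 \<le> i, j < n\<close>. It is the
  product of the adjoint of the observability matrix with the controllability matrix, so it is
  nonsingular if and only if \<open>U\<close> is minimal (\<open>minimal_iff_hankel\<close>). On the other hand a quotient \<open>a / b\<close> in lowest terms, of degree
  at most \<open>n\<close> and with \<open>b 0 \<noteq> 0\<close>, has degree exactly \<open>n\<close> if and only if its Hankel matrix is
  nonsingular (\<open>hankel_nonsingular_iff\<close>).

  A realization of a given inner function comes from the Schur algorithm: if \<open>S\<close> is inner of degree
  at most \<open>n + 1\<close> with \<open>s = S 0\<close> of modulus less than \<open>1\<close>, then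
  \<open>S\<^sub>1 = (S - s) / (z (1 - cnj s * S))\<close> is inner of degree at most \<open>n\<close>, and a unitary matrix for \<open>S\<close>
  is built from one for \<open>S\<^sub>1\<close> (\<open>schur_step_realization\<close>). If the modulus is
  \<open>1\<close>, then \<open>S\<close> is constant. Minimality of the matrix so obtained then follows from the degree.

  Finally, orthonormality of the columns of \<open>U\<close> expresses the inner product of \<open>D^j C\<close> and \<open>D^k C\<close>
  recursively through the Taylor coefficients (\<open>krylov_gram_rec\<close>). Two unitary matrices with the same
  transfer function thus have the same Gram matrices, and when these vectors span the state space, the
  linear map that takes the vectors of one to those of the other is unitary and intertwines the two
  matrices (\<open>markov_eq_imp_equivalent_mat\<close>).
\<close>

section \<open>Adjoints and unitary matrices\<close>

lemma mult_mat_index_sum: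
  fixes A B :: "'a :: semiring_0 mat"
  assumes "A \<in> carrier_mat m n" "B \<in> carrier_mat n l" "i < m" "j < l"
  shows "(A * B) $$ (i,j) = (\<Sum>k<n. A $$ (i,k) * B $$ (k,j))"
  using assms by (simp add: scalar_prod_def atLeast0LessThan)

lemma pow_mat_add:
  fixes D :: "'a :: semiring_1 mat"
  assumes D: "D \<in> carrier_mat n n"
  shows "D ^\<^sub>m (i + k) = D ^\<^sub>m i * D ^\<^sub>m k"
proof (induction k)
  case 0
  show ?case using D pow_carrier_mat[OF D, of i] by simp
next
  case (Suc k)
  show ?case
    using Suc assoc_mult_mat[OF pow_carrier_mat[OF D] pow_carrier_mat[OF D] D, of i k] by simp
qed

lemma mat_adjoint_carrier: "A \<in> carrier_mat m n \<Longrightarrow> mat_adjoint A \<in> carrier_mat n m"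
  by (auto simp: mat_adjoint_def)

lemma mat_adjoint_index:
  "A \<in> carrier_mat m n \<Longrightarrow> i < n \<Longrightarrow> j < m \<Longrightarrow> mat_adjoint A $$ (i,j) = cnj (A $$ (j,i))" for A :: "complex mat"
  by (simp add: mat_adjoint_def mat_of_rows_index)

lemma mat_adjoint_mult_index:
  fixes U V :: "complex mat"
  assumes "U \<in> carrier_mat m l" "V \<in> carrier_mat m l'" "j < l" "k < l'"
  shows "(mat_adjoint U * V) $$ (j,k) = (\<Sum>i<m. cnj (U $$ (i,j)) * V $$ (i,k))"
  using assms by (simp add: mat_adjoint_def scalar_prod_def mat_of_rows_index atLeast0LessThan)

lemma mat_adjoint_mult:
  fixes A B :: "complex mat"
  assumes "A \<in> carrier_mat m n" "B \<in> carrier_mat n l"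
  shows "mat_adjoint (A * B) = mat_adjoint B * mat_adjoint A"
proof (rule eq_matI)
  note c = mat_adjoint_carrier[OF assms(1)] mat_adjoint_carrier[OF assms(2)]
  show "dim_row (mat_adjoint (A * B)) = dim_row (mat_adjoint B * mat_adjoint A)"
    "dim_col (mat_adjoint (A * B)) = dim_col (mat_adjoint B * mat_adjoint A)"
    using mat_adjoint_carrier[OF mult_carrier_mat[OF assms]] c by auto
  fix i j assume "i < dim_row (mat_adjoint B * mat_adjoint A)" "j < dim_col (mat_adjoint B * mat_adjoint A)"
  with assms c show "mat_adjoint (A * B) $$ (i,j) = (mat_adjoint B * mat_adjoint A) $$ (i,j)"
    by (simp add: mat_adjoint_index[OF mult_carrier_mat[OF assms]] scalar_prod_def
        mat_adjoint_index[OF assms(1)] mat_adjoint_index[OF assms(2)] mult.commute)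
qed

lemma mat_adjoint_one: "mat_adjoint (1\<^sub>m n :: complex mat) = 1\<^sub>m n"
  using mat_adjoint_carrier[of "1\<^sub>m n :: complex mat" n n]
  by (intro eq_matI) (auto simp: mat_adjoint_index[of _ n n])

lemma mat_adjoint_pow:
  fixes D :: "complex mat"
  assumes D: "D \<in> carrier_mat n n"
  shows "mat_adjoint (D ^\<^sub>m k) = mat_adjoint D ^\<^sub>m k"
proof (induction k)
  case 0
  show ?case using D mat_adjoint_carrier[OF D] by (simp add: mat_adjoint_one)
next
  case (Suc k)
  have "D ^\<^sub>m Suc k = D * D ^\<^sub>m k" using pow_mat_add[OF D, of 1 k] D by simp
  hence "mat_adjoint (D ^\<^sub>m Suc k) = mat_adjoint (D ^\<^sub>m k) * mat_adjoint D"
    using mat_adjoint_mult[OF D pow_carrier_mat[OF D]] by simp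
  thus ?case using Suc by simp
qed

lemma det_mat_adjoint_eq_0_iff:
  fixes A :: "complex mat"
  assumes A: "A \<in> carrier_mat n n"
  shows "Determinant.det (mat_adjoint A) = 0 \<longleftrightarrow> Determinant.det A = 0"
proof -
  interpret comm_ring_hom cnj by unfold_locales auto
  have "mat_adjoint A = map_mat cnj (transpose_mat A)"
    using A mat_adjoint_carrier[OF A] by (intro eq_matI) (auto simp: mat_adjoint_index[OF A])
  hence "Determinant.det (mat_adjoint A) = cnj (Determinant.det A)"
    using hom_det[of "transpose_mat A"] Determinant.det_transpose[OF A] by simp
  thus ?thesis by simp
qed

lemma unitary_mat_iff:
  "unitary_mat m U \<longleftrightarrow> U \<in> carrier_mat m m \<and>
    (\<forall>j<m. \<forall>k<m. (\<Sum>i<m. cnj (U $$ (i,j)) * U $$ (i,k)) = (if j = k then 1 else 0))"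
  (is "_ \<longleftrightarrow> _ \<and> ?orth")
proof (cases "U \<in> carrier_mat m m")
  case c: True
  hence ca: "mat_adjoint U \<in> carrier_mat m m" by (auto simp: mat_adjoint_def)
  have "?orth \<longleftrightarrow> mat_adjoint U * U = 1\<^sub>m m"
  proof
    assume ?orth
    with c ca show "mat_adjoint U * U = 1\<^sub>m m"
      by (intro eq_matI) (auto simp: mat_adjoint_mult_index[OF c c] simp del: index_mult_mat(1))
  next
    assume UU: "mat_adjoint U * U = 1\<^sub>m m"
    show ?orth
      using UU mat_adjoint_mult_index[OF c c] by (metis index_one_mat(1))
  qed
  moreover have "mat_adjoint U * U = 1\<^sub>m m \<Longrightarrow> U * mat_adjoint U = 1\<^sub>m m"
    by (rule mat_mult_left_right_inverse[OF ca c])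
  ultimately show ?thesis using c by (auto simp: unitary_mat_def)
qed (simp add: unitary_mat_def)

lemma unitary_mat_isometry:
  assumes U: "unitary_mat m U"
    and v: "\<And>i. i < m \<Longrightarrow> v' i = (\<Sum>j<m. U $$ (i,j) * v j)"
    and w: "\<And>i. i < m \<Longrightarrow> w' i = (\<Sum>j<m. U $$ (i,j) * w j)"
  shows "(\<Sum>i<m. cnj (v' i) * w' i) = (\<Sum>j<m. cnj (v j) * w j)"
proof -
  have orth: "(\<Sum>i<m. cnj (U $$ (i,j)) * U $$ (i,k)) = (if j = k then 1 else 0)"
    if "j < m" "k < m" for j k
    using U that by (simp add: unitary_mat_iff)
  have "(\<Sum>i<m. cnj (v' i) * w' i) =
      (\<Sum>i<m. \<Sum>j<m. \<Sum>k<m. (cnj (v j) * w k) * (cnj (U $$ (i,j)) * U $$ (i,k)))"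
  proof (intro sum.cong refl)
    fix i assume "i \<in> {..<m}"
    hence "cnj (v' i) * w' i =
        (\<Sum>j<m. \<Sum>k<m. (cnj (U $$ (i,j)) * cnj (v j)) * (U $$ (i,k) * w k))"
      by (simp add: v w sum_product)
    thus "cnj (v' i) * w' i =
        (\<Sum>j<m. \<Sum>k<m. (cnj (v j) * w k) * (cnj (U $$ (i,j)) * U $$ (i,k)))"
      by (simp only: mult_ac)
  qed
  also have "\<dots> = (\<Sum>j<m. \<Sum>i<m. \<Sum>k<m. (cnj (v j) * w k) * (cnj (U $$ (i,j)) * U $$ (i,k)))"
    by (rule sum.swap)
  also have "\<dots> = (\<Sum>j<m. \<Sum>k<m. (cnj (v j) * w k) * (\<Sum>i<m. cnj (U $$ (i,j)) * U $$ (i,k)))"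
    unfolding sum_distrib_left by (intro sum.cong refl sum.swap)
  also have "\<dots> = (\<Sum>j<m. \<Sum>k<m. if j = k then cnj (v j) * w k else 0)"
    by (intro sum.cong) (auto simp: orth)
  also have "\<dots> = (\<Sum>j<m. cnj (v j) * w j)" by simp
  finally show ?thesis .
qed

section \<open>Polynomial realizations and Taylor coefficients\<close>

text \<open>
  The input \<open>(p, z y\<^sub>1, \<dots>, z y\<^sub>n)\<close> of the system: entry \<open>0\<close> is the external input \<open>p\<close>, and the
  states \<open>y\<^sub>1, \<dots>, y\<^sub>n\<close> are fed back with a factor \<open>z\<close>. The output \<open>y\<^sub>0\<close> is not fed back.
\<close>

definition feed :: "complex poly \<Rightarrow> (nat \<Rightarrow> complex poly) \<Rightarrow> nat \<Rightarrow> complex poly" where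
  "feed p y j = (if j = 0 then p else [:0, 1:] * y j)"

text \<open>
  The polynomials \<open>y\<^sub>0, \<dots>, y\<^sub>n\<close> solve the closed loop with input \<open>p\<close>; for \<open>p \<noteq> 0\<close> the quotient \<open>y\<^sub>0 / p\<close>
  is the transfer function of \<open>U\<close>. The values of \<open>y\<close> beyond \<open>n\<close> are irrelevant.
\<close>

definition realizes :: "nat \<Rightarrow> complex mat \<Rightarrow> complex poly \<Rightarrow> (nat \<Rightarrow> complex poly) \<Rightarrow> bool" where
  "realizes n U p y \<longleftrightarrow> (\<forall>i<Suc n. y i = (\<Sum>j<Suc n. [:U $$ (i,j):] * feed p y j))"

text \<open>
  The impulse response of \<open>U\<close>: at time \<open>k\<close> it consists of the output \<open>s\<^sub>k\<close>, at index \<open>0\<close>, and the state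
  \<open>D^k C\<close>, at the indices \<open>1, \<dots>, n\<close>. All entries of time \<open>k + 1\<close> arise by applying \<open>U\<close> to the vector
  of time \<open>k\<close> with its entry \<open>0\<close> replaced by zero.
\<close>

fun orbit :: "nat \<Rightarrow> complex mat \<Rightarrow> nat \<Rightarrow> nat \<Rightarrow> complex" where
  "orbit n U 0 i = U $$ (i, 0)"
| "orbit n U (Suc k) i = (\<Sum>l<n. U $$ (i, Suc l) * orbit n U k (Suc l))"

text \<open>
  The Taylor series of the transfer function at \<open>0\<close>, with coefficients \<open>A\<close> and \<open>B D^k C\<close>.
\<close>

definition markov :: "nat \<Rightarrow> complex mat \<Rightarrow> complex fps" where
  "markov n U = Abs_fps (\<lambda>k. orbit n U k 0)"

text \<open>
  The input \<open>p\<close> is a superposition of delayed impulses, so every solution is the convolution of \<open>p\<close>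
  with the impulse response. In particular the solution is determined by \<open>p\<close>.
\<close>

lemma realizes_coeff:
  assumes r: "realizes n U p y" and "i \<le> n"
  shows "coeff (y i) k = (\<Sum>j\<le>k. coeff p (k - j) * orbit n U j i)"
  using \<open>i \<le> n\<close>
proof (induction k arbitrary: i)
  case 0
  have "y i = (\<Sum>j<Suc n. [:U $$ (i,j):] * feed p y j)"
    using r 0 by (simp add: realizes_def)
  hence "coeff (y i) 0 = coeff (\<Sum>j<Suc n. [:U $$ (i,j):] * feed p y j) 0" by simp
  thus ?case unfolding sum.lessThan_Suc_shift by (simp add: feed_def coeff_sum)
next
  case (Suc k)
  have "y i = (\<Sum>j<Suc n. [:U $$ (i,j):] * feed p y j)"
    using r Suc.prems by (simp add: realizes_def)
  hence "coeff (y i) (Suc k) = coeff (\<Sum>j<Suc n. [:U $$ (i,j):] * feed p y j) (Suc k)" by simp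
  also have "\<dots> = U $$ (i,0) * coeff p (Suc k) + (\<Sum>l<n. U $$ (i,Suc l) * coeff (y (Suc l)) k)"
    unfolding sum.lessThan_Suc_shift by (simp add: feed_def coeff_sum)
  also have "(\<Sum>l<n. U $$ (i,Suc l) * coeff (y (Suc l)) k) =
      (\<Sum>l<n. \<Sum>j\<le>k. coeff p (k - j) * (U $$ (i,Suc l) * orbit n U j (Suc l)))"
    by (intro sum.cong) (auto simp: Suc.IH sum_distrib_left mult_ac)
  also have "\<dots> = (\<Sum>j\<le>k. coeff p (k - j) * orbit n U (Suc j) i)"
    by (subst sum.swap) (simp add: sum_distrib_left)
  finally show ?case unfolding sum.atMost_Suc_shift by (simp add: mult.commute)
qed

lemma realizes_fps:
  assumes "realizes n U p y"
  shows "fps_of_poly (y 0) = fps_of_poly p * markov n U"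
proof (rule fps_ext)
  fix k
  show "fps_nth (fps_of_poly (y 0)) k = fps_nth (fps_of_poly p * markov n U) k"
    unfolding mult.commute[of "fps_of_poly p"]
    by (simp add: realizes_coeff[OF assms] fps_mult_nth markov_def atLeast0AtMost)
      (simp add: mult.commute)
qed

lemma realizes_markov_eq_iff:
  assumes "realizes n U p y" "realizes n U' p' y'" "coeff p 0 \<noteq> 0" "coeff p' 0 \<noteq> 0"
  shows "Fract (y 0) p = Fract (y' 0) p' \<longleftrightarrow> markov n U = markov n U'"
proof -
  have nz: "p \<noteq> 0" "p' \<noteq> 0" using assms by auto
  hence "Fract (y 0) p = Fract (y' 0) p' \<longleftrightarrow> fps_of_poly (y 0 * p') = fps_of_poly (y' 0 * p)"
    by (simp add: eq_fract)
  also have "\<dots> \<longleftrightarrow> fps_of_poly (p * p') * markov n U = fps_of_poly (p * p') * markov n U'"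
    by (simp add: fps_of_poly_mult realizes_fps[OF assms(1)] realizes_fps[OF assms(2)] mult_ac)
  also have "\<dots> \<longleftrightarrow> markov n U = markov n U'"
    using nz by simp
  finally show ?thesis .
qed

text \<open>
  The norm identity behind innerness: \<open>U\<close> maps the input vector isometrically to the
  output vector at each point \<open>z\<close>.
\<close>

lemma realizes_unitary:
  assumes U: "unitary_mat (n + 1) U" and r: "realizes n U p y"
  shows "(cmod (poly p z))\<^sup>2 - (cmod (poly (y 0) z))\<^sup>2 =
    (1 - (cmod z)\<^sup>2) * (\<Sum>l<n. (cmod (poly (y (Suc l)) z))\<^sup>2)"
proof -
  have e: "poly (y i) z = (\<Sum>j<n+1. U $$ (i,j) * poly (feed p y j) z)" if "i < n + 1" for i
  proof -
    have "y i = (\<Sum>j<Suc n. [:U $$ (i,j):] * feed p y j)"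
      using r that by (simp add: realizes_def)
    from arg_cong[OF this, of "\<lambda>q. poly q z"] show ?thesis by (simp add: poly_sum)
  qed
  have "(\<Sum>i<Suc n. cnj (poly (y i) z) * poly (y i) z) =
      (\<Sum>j<Suc n. cnj (poly (feed p y j) z) * poly (feed p y j) z)"
    using unitary_mat_isometry[OF U e e] by simp
  hence "complex_of_real (\<Sum>i<Suc n. (cmod (poly (y i) z))\<^sup>2) =
      of_real (\<Sum>j<Suc n. (cmod (poly (feed p y j) z))\<^sup>2)"
    by (simp only: of_real_sum complex_norm_square mult.commute[of "cnj _"])
  hence "(\<Sum>i<Suc n. (cmod (poly (y i) z))\<^sup>2) = (\<Sum>j<Suc n. (cmod (poly (feed p y j) z))\<^sup>2)"
    by (simp only: of_real_eq_iff)
  thus ?thesis unfolding sum.lessThan_Suc_shift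
    by (simp add: feed_def norm_mult power_mult_distrib sum_distrib_left algebra_simps sum_subtractf)
qed

section \<open>The transfer function as a quotient of polynomials\<close>

lemma split_block_one:
  assumes "U \<in> carrier_mat (n + 1) (n + 1)"
  shows "split_block U 1 1 = (mat 1 1 (\<lambda>ij. U $$ ij), mat 1 n (\<lambda>(i,j). U $$ (i, Suc j)),
    mat n 1 (\<lambda>(i,j). U $$ (Suc i, j)), mat n n (\<lambda>(i,j). U $$ (Suc i, Suc j)))"
  using assms by (auto simp: split_block_def Let_def)

lemma degree_const_mult_le: "degree ([:c:] * p) \<le> degree p"
  using degree_smult_le[of c p] by simp

lemma degree_adj_mat_linear:
  fixes M :: "'a :: {comm_ring_1, semiring_no_zero_divisors} poly mat"
  assumes M: "M \<in> carrier_mat n n" and d: "\<And>i j. i < n \<Longrightarrow> j < n \<Longrightarrow> degree (M $$ (i,j)) \<le> 1"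
    and ij: "i < n" "j < n"
  shows "degree (adj_mat M $$ (i,j)) \<le> n - 1"
proof -
  have "degree (Determinant.det (mat_delete M j i)) \<le> 1 * (n - 1)"
  proof (rule degree_det_le)
    show "mat_delete M j i \<in> carrier_mat (n - 1) (n - 1)" using M by (auto simp: mat_delete_def)
    fix k l assume "k < n - 1" "l < n - 1"
    thus "degree (mat_delete M j i $$ (k, l)) \<le> 1"
      using M by (auto simp: mat_delete_def intro!: d[unfolded One_nat_def])
  qed
  moreover have "degree ((-1) ^ (j + i) * q) = degree q" for q :: "'a poly"
    by (cases "even (j + i)") auto
  ultimately show ?thesis using M ij by (simp add: adj_mat_def cofactor_def)
qed

text \<open>
  The solution with \<open>p = det (I - z D)\<close> and states \<open>adj (I - z D) C\<close>, whose quotient \<open>y\<^sub>0 / p\<close> is Cramer's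
  rule for the inverse in the transfer function.
\<close>

lemma realization_of_transfer_fun:
  assumes U: "U \<in> carrier_mat (n + 1) (n + 1)"
  shows "\<exists>p y. realizes n U p y \<and> coeff p 0 = 1 \<and> degree p \<le> n \<and> degree (y 0) \<le> n \<and>
    transfer_fun n U = Fract (y 0) p"
proof -
  define k where "k = (\<lambda>c::complex. [:c:])"
  obtain A B C D where s: "split_block U 1 1 = (A, B, C, D)" by (metis prod_cases4)
  note blocks = s[unfolded split_block_one[OF U]]
  have c: "A \<in> carrier_mat 1 1" "B \<in> carrier_mat 1 n" "C \<in> carrier_mat n 1" "D \<in> carrier_mat n n"
    using blocks by auto
  define M where "M = 1\<^sub>m n - [:0,1:] \<cdot>\<^sub>m map_mat k D"
  define p where "p = Determinant.det M"
  define \<xi> where "\<xi> = adj_mat M * map_mat k C"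
  define y where "y = (\<lambda>i. case i of
    0 \<Rightarrow> transfer_num (map_mat k A) (map_mat k B) (map_mat k C) M [:0,1:] | Suc l \<Rightarrow> \<xi> $$ (l, 0))"
  have M: "M \<in> carrier_mat n n" using c by (auto simp: M_def)
  note adj = adj_mat[OF M]
  have \<xi>: "\<xi> \<in> carrier_mat n 1" using adj c by (auto simp: \<xi>_def)
  have Mdeg: "degree (M $$ (i,j)) \<le> 1" if "i < n" "j < n" for i j
    using c that by (auto simp: M_def k_def intro!: degree_diff_le)
  have dp: "degree p \<le> n"
    using degree_det_le[of n M 1, OF Mdeg M] by (simp add: p_def)
  have p0: "coeff p 0 = 1"
  proof -
    have "map_mat (\<lambda>q. poly q 0) M = 1\<^sub>m n"
      using c by (intro eq_matI) (auto simp: M_def k_def)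
    hence "poly p 0 = 1"
      using comm_ring_hom.hom_det[OF comm_ring_hom_poly[of 0], of M] by (simp add: p_def)
    thus ?thesis by (simp add: poly_0_coeff_0)
  qed
  have y0: "y 0 = [:U $$ (0,0):] * p + (\<Sum>l<n. [:U $$ (0, Suc l):] * ([:0,1:] * y (Suc l)))"
  proof -
    have "map_mat k B * adj_mat M * map_mat k C = map_mat k B * \<xi>"
      unfolding \<xi>_def by (rule assoc_mult_mat) (use c adj in auto)
    hence "y 0 = p * k (U $$ (0,0)) + [:0,1:] * (\<Sum>l<n. k (U $$ (0, Suc l)) * \<xi> $$ (l, 0))"
      using c \<xi> blocks by (auto simp: y_def transfer_num_def p_def scalar_prod_def atLeast0LessThan)
    thus ?thesis by (simp add: k_def y_def sum_distrib_left mult_ac)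
  qed
  \<comment> \<open>the states satisfy \<open>(I - z D) \<xi> = p C\<close>, that is \<open>\<xi> = p C + z D \<xi>\<close>\<close>
  have yS: "y (Suc i) = [:U $$ (Suc i,0):] * p + (\<Sum>l<n. [:U $$ (Suc i, Suc l):] * ([:0,1:] * y (Suc l)))"
    if i: "i < n" for i
  proof -
    have "M * \<xi> = p \<cdot>\<^sub>m map_mat k C"
    proof -
      have "M * \<xi> = (M * adj_mat M) * map_mat k C"
        unfolding \<xi>_def by (rule assoc_mult_mat[symmetric]) (use c M adj in auto)
      thus ?thesis unfolding adj(2) p_def using c by (simp add: mult_smult_assoc_mat[of _ n n _ 1])
    qed
    hence "(M * \<xi>) $$ (i,0) = p * k (U $$ (Suc i, 0))"
      using i c blocks by auto
    moreover have "(M * \<xi>) $$ (i,0) = (\<Sum>l<n. ((if l = i then 1 else 0) - [:0,1:] * k (U $$ (Suc i, Suc l))) * \<xi> $$ (l, 0))"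
      using i c M \<xi> blocks by (auto simp: scalar_prod_def atLeast0LessThan M_def intro!: sum.cong)
    moreover have "\<dots> = (\<Sum>l<n. if l = i then \<xi> $$ (l,0) else 0) -
        (\<Sum>l<n. k (U $$ (Suc i, Suc l)) * ([:0,1:] * \<xi> $$ (l, 0)))"
      unfolding sum_subtractf[symmetric]
      by (intro sum.cong refl) (simp add: left_diff_distrib mult.left_commute mult.assoc del: mult_pCons_left mult_pCons_right)
    moreover have "(\<Sum>l<n. if l = i then \<xi> $$ (l,0) else 0) = y (Suc i)"
      using i by (simp add: y_def)
    ultimately have "y (Suc i) - (\<Sum>l<n. k (U $$ (Suc i, Suc l)) * ([:0,1:] * \<xi> $$ (l, 0))) =
        p * k (U $$ (Suc i, 0))"
      by (simp only:)
    hence "y (Suc i) = k (U $$ (Suc i, 0)) * p + (\<Sum>l<n. k (U $$ (Suc i, Suc l)) * ([:0,1:] * \<xi> $$ (l, 0)))"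
      by (simp only: diff_eq_eq mult.commute[of p])
    thus ?thesis by (simp only: k_def y_def nat.case)
  qed
  have r: "realizes n U p y"
    unfolding realizes_def sum.lessThan_Suc_shift
  proof (intro allI impI)
    fix i assume i: "i < Suc n"
    have f: "feed p y 0 = p" "feed p y (Suc l) = [:0,1:] * y (Suc l)" for l
      by (simp_all only: feed_def if_True if_False nat.distinct simp_thms)
    show "y i = [:U $$ (i,0):] * feed p y 0 + (\<Sum>l<n. [:U $$ (i, Suc l):] * feed p y (Suc l))"
      unfolding f
    proof (cases i)
      case 0
      show "y i = [:U $$ (i,0):] * p + (\<Sum>l<n. [:U $$ (i, Suc l):] * ([:0,1:] * y (Suc l)))"
        unfolding 0 by (rule y0)
    next
      case (Suc l)
      show "y i = [:U $$ (i,0):] * p + (\<Sum>l<n. [:U $$ (i, Suc l):] * ([:0,1:] * y (Suc l)))"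
        unfolding Suc by (rule yS) (use i Suc in simp)
    qed
  qed
  have dy: "degree (y (Suc l)) \<le> n - 1" if "l < n" for l
  proof -
    have "y (Suc l) = (\<Sum>m<n. adj_mat M $$ (l, m) * [:C $$ (m, 0):])"
      using that c adj by (simp add: y_def \<xi>_def scalar_prod_def atLeast0LessThan k_def)
    also have "degree \<dots> \<le> n - 1"
      using that degree_adj_mat_linear[OF M Mdeg]
      by (intro degree_sum_le) (auto intro: order.trans[OF degree_smult_le])
    finally show ?thesis .
  qed
  have "degree ([:U $$ (0, Suc l):] * ([:0,1:] * y (Suc l))) \<le> n" if "l < n" for l
    by (rule order.trans[OF degree_const_mult_le]) (use dy[OF that] that in auto)
  hence dy0: "degree (y 0) \<le> n"
    unfolding y0 using dp
    by (intro degree_add_le degree_sum_le) (auto intro: order.trans[OF degree_const_mult_le] simp del: mult_pCons_left)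
  have tf: "map_mat to_fract (map_mat k X) = map_mat rat_const X" for X
    by (intro eq_matI) (auto simp: k_def rat_const_def)
  have Mf: "map_mat to_fract M = 1\<^sub>m n - rat_var \<cdot>\<^sub>m map_mat rat_const D"
    using c by (intro eq_matI) (auto simp: M_def k_def rat_const_def rat_var_def simp flip: to_fract_mult)
  have sf: "split_block (map_mat rat_const U) 1 1 =
     (map_mat rat_const A, map_mat rat_const B, map_mat rat_const C, map_mat rat_const D)"
    using s U unfolding split_block_def Let_def by (auto intro!: eq_matI)
  have df: "Determinant.det (map_mat to_fract M) = to_fract p"
    unfolding p_def by (rule comm_ring_hom.hom_det[OF comm_ring_hom_to_fract])
  have "transfer_num (map_mat rat_const A) (map_mat rat_const B) (map_mat rat_const C)
      (map_mat to_fract M) rat_var = to_fract (y 0)"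
    using hom_transfer_num[OF comm_ring_hom_to_fract _ _ _ M, of "map_mat k A" "map_mat k B" "map_mat k C" "[:0,1:]"] c
    by (simp add: tf rat_var_def y_def)
  moreover have "p \<noteq> 0" using p0 by auto
  ultimately have "transfer_fun n U = to_fract (y 0) / to_fract p"
    unfolding transfer_fun_def sf prod.case Mf[symmetric]
    using transfer_entry[of "map_mat rat_const A" "map_mat rat_const B" n "map_mat rat_const C" "map_mat to_fract M" rat_var]
      c M df by auto
  hence "transfer_fun n U = Fract (y 0) p" by (simp add: Fract_conv_to_fract)
  with r p0 dp dy0 show ?thesis by blast
qed

lemma transfer_fun_eq_iff_markov:
  assumes "U \<in> carrier_mat (n + 1) (n + 1)" "U' \<in> carrier_mat (n + 1) (n + 1)"
  shows "transfer_fun n U = transfer_fun n U' \<longleftrightarrow> markov n U = markov n U'"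
  using realization_of_transfer_fun[OF assms(1)] realization_of_transfer_fun[OF assms(2)]
  by (metis realizes_markov_eq_iff zero_neq_one)

lemma transfer_fun_eq_Fract:
  assumes "U \<in> carrier_mat (n + 1) (n + 1)" "realizes n U p y" "coeff p 0 \<noteq> 0"
  shows "transfer_fun n U = Fract (y 0) p"
  using realization_of_transfer_fun[OF assms(1)] realizes_markov_eq_iff[OF _ assms(2) _ assms(3)]
  by (metis zero_neq_one)

text \<open>
  The polynomial \<open>g\<close> is the factor common to \<open>p = b g\<close> and \<open>y\<^sub>0 = a g\<close> that cancels in lowest terms.
\<close>

lemma transfer_fun_lowest_terms:
  assumes U: "U \<in> carrier_mat (n + 1) (n + 1)" and ab: "quot_of_fract (transfer_fun n U) = (a, b)"
  obtains y g where "realizes n U (b * g) y" "y 0 = a * g" "g \<noteq> 0"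
    "coprime a b" "coeff b 0 \<noteq> 0" "degree a \<le> n" "degree b \<le> n"
    "fps_of_poly a = fps_of_poly b * markov n U"
proof -
  obtain p y where r: "realizes n U p y" and p: "coeff p 0 = 1" "degree p \<le> n" "degree (y 0) \<le> n"
    and S: "transfer_fun n U = Fract (y 0) p"
    using realization_of_transfer_fun[OF U] by blast
  have b: "b \<noteq> 0" "coprime a b"
    using ab snd_quot_of_fract_nonzero[of "transfer_fun n U"] coprime_quot_of_fract[of "transfer_fun n U"] by auto
  have p0: "p \<noteq> 0" using p by auto
  have "Fract a b = Fract (y 0) p" using ab Fract_quot_of_fract[of "transfer_fun n U"] S by simp
  hence eq: "a * p = y 0 * b" using p0 b by (simp add: eq_fract)
  have "b dvd p" using eq b(2) by (metis coprime_commute coprime_dvd_mult_right_iff dvd_triv_right)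
  then obtain g where g: "p = b * g" by (elim dvdE)
  hence g0: "g \<noteq> 0" using p0 by auto
  have y0: "y 0 = a * g" using eq b(1) by (simp add: g mult_ac)
  have "coeff b 0 \<noteq> 0" using p(1) by (auto simp: g coeff_mult_0)
  moreover have "degree b \<le> n" using p(2) b(1) g0 by (simp add: g degree_mult_eq)
  moreover have "degree a \<le> n" using p(3) g0 by (cases "a = 0") (simp_all add: y0 degree_mult_eq)
  moreover have "fps_of_poly a = fps_of_poly b * markov n U"
  proof -
    have "fps_of_poly g * fps_of_poly a = fps_of_poly g * (fps_of_poly b * markov n U)"
      using realizes_fps[OF r] by (simp add: g y0 fps_of_poly_mult mult_ac)
    thus ?thesis using g0 by simp
  qed
  ultimately show thesis using that[of g y] r g y0 g0 b(2) by blast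
qed

lemma rat_degree_transfer_fun_le:
  assumes "U \<in> carrier_mat (n + 1) (n + 1)"
  shows "rat_degree (transfer_fun n U) \<le> n"
proof -
  obtain a b where ab: "quot_of_fract (transfer_fun n U) = (a, b)" by force
  from transfer_fun_lowest_terms[OF assms ab] show ?thesis by (auto simp: rat_degree_def ab)
qed

section \<open>Hankel matrices, minimality and degree\<close>

lemma orbit_eq_pow:
  assumes U: "U \<in> carrier_mat (n + 1) (n + 1)" and s: "split_block U 1 1 = (A, B, C, D)"
    and l: "l < n"
  shows "orbit n U k (Suc l) = (D ^\<^sub>m k * C) $$ (l, 0)"
proof -
  note blocks = s[unfolded split_block_one[OF U]]
  have c: "C \<in> carrier_mat n 1" "D \<in> carrier_mat n n" using blocks by auto
  note Dk = pow_carrier_mat[OF c(2)]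
  show ?thesis using l
  proof (induction k arbitrary: l)
    case 0
    thus ?case using c blocks by auto
  next
    case (Suc k)
    have "D ^\<^sub>m Suc k * C = D * (D ^\<^sub>m k * C)"
    proof -
      have "D ^\<^sub>m Suc k = D * D ^\<^sub>m k"
        using pow_mat_add[OF c(2), of 1 k] c by simp
      thus ?thesis using assoc_mult_mat[OF c(2) Dk c(1)] by simp
    qed
    also have "\<dots> $$ (l, 0) = (\<Sum>m<n. U $$ (Suc l, Suc m) * (D ^\<^sub>m k * C) $$ (m, 0))"
      using Suc.prems c Dk[of k] blocks
      by (auto simp: scalar_prod_def atLeast0LessThan intro!: sum.cong)
    finally show ?case using Suc.IH by simp
  qed
qed

lemma krylov_mat_carrier: "krylov_mat n D C \<in> carrier_mat n n"
  unfolding krylov_mat_def using mat_of_cols_carrier(1)[of n "map (\<lambda>k. col (D ^\<^sub>m k * C) 0) [0..<n]"] by simp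

lemma krylov_mat_index:
  assumes "D \<in> carrier_mat n n" "C \<in> carrier_mat n 1" "l < n" "k < n"
  shows "krylov_mat n D C $$ (l, k) = (D ^\<^sub>m k * C) $$ (l, 0)"
  using assms pow_carrier_mat[OF assms(1)] by (simp add: krylov_mat_def mat_of_cols_index)

lemma controllable_iff:
  assumes U: "U \<in> carrier_mat (n + 1) (n + 1)"
  shows "controllable n U \<longleftrightarrow> Determinant.det (mat n n (\<lambda>(l,k). orbit n U k (Suc l))) \<noteq> 0"
proof -
  obtain A B C D where s: "split_block U 1 1 = (A, B, C, D)" by (metis prod_cases4)
  have c: "C \<in> carrier_mat n 1" "D \<in> carrier_mat n n" using s[unfolded split_block_one[OF U]] by auto
  have "krylov_mat n D C = mat n n (\<lambda>(l,k). orbit n U k (Suc l))"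
    using krylov_mat_carrier[of n D C]
    by (intro eq_matI) (auto simp: krylov_mat_index[OF c(2,1)] orbit_eq_pow[OF U s])
  thus ?thesis unfolding controllable_def s prod.case
    using vec_space.det_rank_iff[OF krylov_mat_carrier[of n D C]] by simp
qed

text \<open>
  The \<open>n \<times> n\<close> Hankel matrix of a power series. The constant coefficient does not enter.
\<close>

definition hankel :: "nat \<Rightarrow> complex fps \<Rightarrow> complex mat" where
  "hankel n F = mat n n (\<lambda>(i,j). fps_nth F (i + j + 1))"

text \<open>
  Since \<open>s\<^sub>i\<^sub>+\<^sub>j\<^sub>+\<^sub>1 = (B D^i) (D^j C)\<close>, the Hankel matrix is the product of the adjoint of the observability
  matrix with the controllability matrix.
\<close>

lemma minimal_iff_hankel:
  assumes U: "U \<in> carrier_mat (n + 1) (n + 1)"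
  shows "minimal_mat n U \<longleftrightarrow> Determinant.det (hankel n (markov n U)) \<noteq> 0"
proof -
  obtain A B C D where s: "split_block U 1 1 = (A, B, C, D)" by (metis prod_cases4)
  note blocks = s[unfolded split_block_one[OF U]]
  have c: "B \<in> carrier_mat 1 n" "C \<in> carrier_mat n 1" "D \<in> carrier_mat n n"
    using blocks by auto
  note ca = mat_adjoint_carrier[OF c(1)] mat_adjoint_carrier[OF c(3)]
  define K where "K = krylov_mat n D C"
  define L where "L = krylov_mat n (mat_adjoint D) (mat_adjoint B)"
  note KL = krylov_mat_carrier[of n D C, folded K_def]
    krylov_mat_carrier[of n "mat_adjoint D" "mat_adjoint B", folded L_def]
  have m: "minimal_mat n U \<longleftrightarrow> Determinant.det K \<noteq> 0 \<and> Determinant.det L \<noteq> 0"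
    unfolding minimal_mat_def controllable_def observable_def s prod.case
    using vec_space.det_rank_iff[OF KL(1)] vec_space.det_rank_iff[OF KL(2)] by (simp add: K_def L_def)
  have "hankel n (markov n U) = mat_adjoint L * K"
  proof (rule eq_matI)
    fix i j assume "i < dim_row (mat_adjoint L * K)" "j < dim_col (mat_adjoint L * K)"
    hence ij: "i < n" "j < n" using KL mat_adjoint_carrier[OF KL(2)] by auto
    note Dp = pow_carrier_mat[OF c(3)]
    have L: "mat_adjoint L $$ (i, l) = (B * D ^\<^sub>m i) $$ (0, l)" if "l < n" for l
    proof -
      have "mat_adjoint L $$ (i, l) = cnj ((mat_adjoint D ^\<^sub>m i * mat_adjoint B) $$ (l, 0))"
        using ij that mat_adjoint_index[OF KL(2), of i l]
        by (simp add: L_def krylov_mat_index[OF ca(2,1)])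
      also have "mat_adjoint D ^\<^sub>m i * mat_adjoint B = mat_adjoint (B * D ^\<^sub>m i)"
        using mat_adjoint_mult[OF c(1) Dp] mat_adjoint_pow[OF c(3)] by simp
      also have "cnj (mat_adjoint (B * D ^\<^sub>m i) $$ (l, 0)) = (B * D ^\<^sub>m i) $$ (0, l)"
        using that by (simp add: mat_adjoint_index[OF mult_carrier_mat[OF c(1) Dp]])
      finally show ?thesis .
    qed
    have K: "K $$ (l, j) = (D ^\<^sub>m j * C) $$ (l, 0)" if "l < n" for l
      using ij that by (simp add: K_def krylov_mat_index[OF c(3,2)])
    have "(mat_adjoint L * K) $$ (i,j) = (\<Sum>l<n. (B * D ^\<^sub>m i) $$ (0,l) * (D ^\<^sub>m j * C) $$ (l,0))"
      unfolding mult_mat_index_sum[OF mat_adjoint_carrier[OF KL(2)] KL(1) ij]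
      by (intro sum.cong refl) (simp only: L K lessThan_iff)
    also have "\<dots> = ((B * D ^\<^sub>m i) * (D ^\<^sub>m j * C)) $$ (0,0)"
      by (rule mult_mat_index_sum[OF mult_carrier_mat[OF c(1) Dp] mult_carrier_mat[OF Dp c(2)], symmetric]) auto
    also have "(B * D ^\<^sub>m i) * (D ^\<^sub>m j * C) = B * (D ^\<^sub>m (i + j) * C)"
      using assoc_mult_mat[OF c(1) Dp mult_carrier_mat[OF Dp c(2)]] assoc_mult_mat[OF Dp Dp c(2)]
        pow_mat_add[OF c(3)] by metis
    also have "\<dots> $$ (0,0) = (\<Sum>l<n. B $$ (0,l) * (D ^\<^sub>m (i + j) * C) $$ (l,0))"
      using c Dp[of "i+j"] by (simp add: scalar_prod_def atLeast0LessThan)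
    also have "\<dots> = orbit n U (Suc (i + j)) 0"
      using blocks by (auto simp: orbit_eq_pow[OF U s] intro!: sum.cong)
    finally show "hankel n (markov n U) $$ (i,j) = (mat_adjoint L * K) $$ (i,j)"
      using ij by (simp add: hankel_def markov_def)
  qed (use KL mat_adjoint_carrier[OF KL(2)] in \<open>auto simp: hankel_def\<close>)
  hence "Determinant.det (hankel n (markov n U)) = Determinant.det (mat_adjoint L) * Determinant.det K"
    using det_mult[OF mat_adjoint_carrier[OF KL(2)] KL(1)] by simp
  thus ?thesis unfolding m by (simp add: det_mat_adjoint_eq_0_iff[OF KL(2)]) blast
qed

lemma fps_mult_nth_hankel:
  assumes "degree Q < n" "i < n"
  shows "fps_nth (fps_of_poly Q * F) (n + i) =
    (hankel n F *\<^sub>v vec n (\<lambda>l. coeff Q (n - 1 - l))) $ i"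
proof -
  have "fps_nth (fps_of_poly Q * F) (n + i) = (\<Sum>j=0..n + i. coeff Q j * fps_nth F (n + i - j))"
    by (simp add: fps_mult_nth)
  also have "\<dots> = (\<Sum>j<n. coeff Q j * fps_nth F (n + i - j))"
    using assms by (intro sum.mono_neutral_right) (auto simp: coeff_eq_0)
  also have "\<dots> = (\<Sum>l<n. coeff Q (n - Suc l) * fps_nth F (n + i - (n - Suc l)))"
    by (rule sum.nat_diff_reindex[symmetric])
  also have "\<dots> = (\<Sum>l<n. coeff Q (n - Suc l) * fps_nth F (i + l + 1))"
    by (intro sum.cong refl arg_cong2[of _ _ _ _ "(*)"] arg_cong[of _ _ "fps_nth F"]) auto
  finally show ?thesis
    using assms(2) by (simp add: hankel_def scalar_prod_def atLeast0LessThan mult.commute)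
qed

text \<open>
  Kernel vectors of the Hankel matrix, read backwards, are the coefficients of polynomials \<open>Q\<close> of degree
  less than \<open>n\<close> for which the coefficients of \<open>Q F\<close> with indices \<open>n, \<dots>, 2 n - 1\<close> vanish.
\<close>

lemma det_hankel_eq_0_iff:
  "Determinant.det (hankel n F) = 0 \<longleftrightarrow>
    (\<exists>Q. Q \<noteq> 0 \<and> degree Q < n \<and> (\<forall>i<n. fps_nth (fps_of_poly Q * F) (n + i) = 0))"
proof -
  have H: "hankel n F \<in> carrier_mat n n" by (simp add: hankel_def)
  show ?thesis unfolding det_0_iff_vec_prod_zero_field[OF H]
  proof safe
    fix v :: "complex vec"
    assume v: "v \<in> carrier_vec n" "v \<noteq> 0\<^sub>v n" and Hv: "hankel n F *\<^sub>v v = 0\<^sub>v n"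
    have n: "n > 0" using v by (cases n) auto
    define Q where "Q = (\<Sum>j<n. monom (v $ (n - 1 - j)) j)"
    have Q: "coeff Q j = (if j < n then v $ (n - 1 - j) else 0)" for j
      by (simp add: Q_def coeff_sum)
    have "degree Q \<le> n - 1" using n by (intro degree_le) (auto simp: Q)
    hence dQ: "degree Q < n" using n by simp
    have vQ: "vec n (\<lambda>l. coeff Q (n - 1 - l)) = v"
      using v(1) by (intro eq_vecI) (auto simp: Q)
    have "Q \<noteq> 0" using v vQ by auto
    moreover have "\<forall>i<n. fps_nth (fps_of_poly Q * F) (n + i) = 0"
      using fps_mult_nth_hankel[OF dQ] by (simp add: vQ[simplified] Hv)
    ultimately show "\<exists>Q. Q \<noteq> 0 \<and> degree Q < n \<and> (\<forall>i<n. fps_nth (fps_of_poly Q * F) (n + i) = 0)"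
      using dQ by blast
  next
    fix Q :: "complex poly"
    assume Q: "Q \<noteq> 0" "degree Q < n" "\<forall>i<n. fps_nth (fps_of_poly Q * F) (n + i) = 0"
    define v where "v = vec n (\<lambda>l. coeff Q (n - 1 - l))"
    have "v $ (n - 1 - degree Q) = coeff Q (degree Q)" using Q(2) by (simp add: v_def)
    hence "v \<noteq> 0\<^sub>v n" using Q(1,2) by auto
    moreover have "hankel n F *\<^sub>v v = 0\<^sub>v n"
      using Q H fps_mult_nth_hankel[OF Q(2), of _ F] by (intro eq_vecI) (auto simp: v_def)
    ultimately show "\<exists>v. v \<in> carrier_vec n \<and> v \<noteq> 0\<^sub>v n \<and> hankel n F *\<^sub>v v = 0\<^sub>v n"
      by (intro exI[of _ v]) (auto simp: v_def)
  qed
qed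

text \<open>
  Kronecker's criterion for the degree. If the degree is less than \<open>n\<close>, then \<open>b\<close> itself gives a kernel
  vector. Conversely a kernel vector gives an approximant \<open>R / Q\<close> of \<open>a / b\<close> with \<open>R\<close> and \<open>Q\<close> of degree
  less than \<open>n\<close> and contact of order \<open>2 n\<close>, which forces \<open>R / Q = a / b\<close>.
\<close>

lemma hankel_nonsingular_iff:
  assumes cop: "coprime a b" and b0: "coeff b 0 \<noteq> 0"
    and deg: "degree a \<le> n" "degree b \<le> n"
    and F: "fps_of_poly a = fps_of_poly b * F"
  shows "Determinant.det (hankel n F) \<noteq> 0 \<longleftrightarrow> max (degree a) (degree b) = n"
proof
  assume H: "Determinant.det (hankel n F) \<noteq> 0"
  show "max (degree a) (degree b) = n"
  proof (rule ccontr)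
    assume "max (degree a) (degree b) \<noteq> n"
    hence "degree a < n" "degree b < n" using deg by auto
    hence "b \<noteq> 0 \<and> degree b < n \<and> (\<forall>i<n. fps_nth (fps_of_poly b * F) (n + i) = 0)"
      using b0 by (auto simp: coeff_eq_0 simp flip: F)
    thus False using H det_hankel_eq_0_iff by blast
  qed
next
  assume m: "max (degree a) (degree b) = n"
  show "Determinant.det (hankel n F) \<noteq> 0"
  proof
    assume "Determinant.det (hankel n F) = 0"
    then obtain Q where Q: "Q \<noteq> 0" "degree Q < n" "\<And>i. i < n \<Longrightarrow> fps_nth (fps_of_poly Q * F) (n + i) = 0"
      by (auto simp: det_hankel_eq_0_iff)
    \<comment> \<open>\<open>R\<close> is \<open>Q F\<close> truncated below \<open>z^n\<close>; the next \<open>n\<close> coefficients of \<open>Q F\<close> are zero\<close>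
    define R where "R = (\<Sum>j<n. monom (fps_nth (fps_of_poly Q * F) j) j)"
    have R: "coeff R j = (if j < n then fps_nth (fps_of_poly Q * F) j else 0)" for j
      by (simp add: R_def coeff_sum)
    have "degree R \<le> n - 1" using Q(2) by (intro degree_le) (auto simp: R)
    hence dR: "degree R < n" using Q(2) by simp
    define G where "G = fps_of_poly Q * F - fps_of_poly R"
    have G: "fps_nth G k = 0" if "k < 2 * n" for k
    proof (cases "k < n")
      case False
      thus ?thesis using Q(3)[of "k - n"] that by (simp add: G_def R)
    qed (simp add: G_def R)
    \<comment> \<open>this polynomial vanishes to order \<open>2 n\<close> at \<open>0\<close> but has degree less than \<open>2 n\<close>\<close>
    have "b * R - Q * a = 0"
    proof (rule poly_eqI)
      fix k
      have e: "fps_of_poly (b * R - Q * a) = - (fps_of_poly b * G)"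
        by (simp add: G_def fps_of_poly_mult fps_of_poly_diff F algebra_simps)
      show "coeff (b * R - Q * a) k = coeff 0 k"
      proof (cases "k < 2 * n")
        case True
        have "coeff (b * R - Q * a) k = fps_nth (- (fps_of_poly b * G)) k" by (simp flip: e)
        also have "\<dots> = 0" using True by (simp add: fps_mult_nth G)
        finally show ?thesis by simp
      next
        case False
        have "degree (b * R) < 2 * n" "degree (Q * a) < 2 * n"
          using degree_mult_le[of b R] degree_mult_le[of Q a] deg dR Q(2) by linarith+
        thus ?thesis using False by (simp add: coeff_eq_0)
      qed
    qed
    hence bR: "b * R = Q * a" by simp
    hence "b dvd Q" using cop by (metis coprime_commute coprime_dvd_mult_left_iff dvd_triv_left)
    then obtain h where h: "Q = b * h" by (elim dvdE)
    hence "b * R = b * (a * h)" using bR by (simp add: mult_ac)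
    moreover have "b \<noteq> 0" "h \<noteq> 0" using h Q(1) by auto
    ultimately have R': "R = a * h" by simp
    have "degree b < n" using Q(2) \<open>b \<noteq> 0\<close> \<open>h \<noteq> 0\<close> by (simp add: h degree_mult_eq)
    moreover have "degree a < n"
      using dR \<open>h \<noteq> 0\<close> Q(2) by (cases "a = 0") (simp_all add: R' degree_mult_eq)
    ultimately show False using m by simp
  qed
qed

lemma rat_degree_transfer_fun_eq_iff:
  assumes U: "U \<in> carrier_mat (n + 1) (n + 1)"
  shows "rat_degree (transfer_fun n U) = n \<longleftrightarrow> minimal_mat n U"
proof -
  obtain a b where ab: "quot_of_fract (transfer_fun n U) = (a, b)" by force
  from transfer_fun_lowest_terms[OF U ab] obtain y g where
    "coprime a b" "coeff b 0 \<noteq> 0" "degree a \<le> n" "degree b \<le> n"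
    "fps_of_poly a = fps_of_poly b * markov n U" by blast
  from hankel_nonsingular_iff[OF this] show ?thesis
    by (simp add: minimal_iff_hankel[OF U] rat_degree_def ab)
qed

section \<open>Transfer functions of unitary matrices are inner\<close>

lemma poly_norm_le_off_finite:
  fixes a b :: "complex poly"
  assumes K: "connected K" "\<And>x. K \<noteq> {x}" and F: "finite F"
    and le: "\<And>z. z \<in> K - F \<Longrightarrow> cmod (poly a z) \<le> cmod (poly b z)" and z: "z \<in> K"
  shows "cmod (poly a z) \<le> cmod (poly b z)"
proof -
  have "z islimpt K" using connected_imp_perfect[OF K(1) z K(2)] .
  moreover have "K \<subseteq> F \<union> (K - F)" by auto
  ultimately have "z islimpt (K - F)"
    using islimpt_subset islimpt_Un_finite[OF F] by blast
  hence z: "z \<in> closure (K - F)" by (simp add: closure_def)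
  have "cmod (poly a z) - cmod (poly b z) \<le> 0"
    by (rule continuous_le_on_closure[OF _ z]) (auto intro!: continuous_intros le)
  thus ?thesis by simp
qed

text \<open>
  For a rational function in lowest terms, being inner means that the denominator has no zeros in the
  closed disc and that the values have modulus at most \<open>1\<close> there and equal to \<open>1\<close> on the circle.
\<close>

lemma rational_inner_iff:
  assumes ab: "quot_of_fract S = (a, b)"
  shows "rational_inner S \<longleftrightarrow>
    (\<forall>z. cmod z \<le> 1 \<longrightarrow> poly b z \<noteq> 0 \<and> cmod (poly a z) \<le> cmod (poly b z)) \<and>
    (\<forall>t. cmod t = 1 \<longrightarrow> cmod (poly a t) = cmod (poly b t))"
  (is "_ \<longleftrightarrow> ?disc \<and> ?circ")
proof
  have b: "b \<noteq> 0" "coprime a b"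
    using ab snd_quot_of_fract_nonzero[of S] coprime_quot_of_fract[of S] by auto
  have ev: "rat_eval S = (\<lambda>z. poly a z / poly b z)" by (auto simp: rat_eval_def ab)
  assume S: "rational_inner S"
  have nz: "poly b t \<noteq> 0" and eq: "cmod (poly a t) = cmod (poly b t)" if "cmod t = 1" for t
  proof -
    have "cmod (poly a t / poly b t) = 1" using S that by (simp add: rational_inner_def ev)
    thus "poly b t \<noteq> 0" "cmod (poly a t) = cmod (poly b t)" by (auto simp: norm_divide)
  qed
  \<comment> \<open>at zeros of \<open>b\<close>, where the value of \<open>S\<close> is \<open>0\<close> by convention, the bound follows by continuity\<close>
  have le: "cmod (poly a z) \<le> cmod (poly b z)" if "z \<in> ball 0 1" for z
  proof (rule poly_norm_le_off_finite[of "ball 0 1" "{z. poly b z = 0}"])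
    show "ball (0::complex) 1 \<noteq> {x}" for x
    proof
      assume "ball (0::complex) 1 = {x}"
      thus False using uncountable_ball[of 1 "0::complex"] by simp
    qed
    show "finite {z. poly b z = 0}" using b(1) by (rule poly_roots_finite)
    fix z assume "z \<in> ball 0 1 - {z. poly b z = 0}"
    hence z: "z \<in> ball 0 1" "poly b z \<noteq> 0" by auto
    hence "cmod (poly a z / poly b z) \<le> 1" using S unfolding rational_inner_def ev by blast
    thus "cmod (poly a z) \<le> cmod (poly b z)" using z(2) by (simp add: norm_divide divide_le_eq_1)
  qed (use that in auto)
  \<comment> \<open>a zero of the denominator would be a zero of the numerator as well\<close>
  have "poly b z \<noteq> 0" if "z \<in> ball 0 1" for z
    using le[OF that] coprime_poly_0[OF b(2), of z] by auto
  hence ?disc using le nz eq by (metis dist_0_norm le_less mem_ball order_refl)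
  thus "?disc \<and> ?circ" using eq by blast
next
  assume *: "?disc \<and> ?circ"
  have ev: "rat_eval S = (\<lambda>z. poly a z / poly b z)" by (auto simp: rat_eval_def ab)
  show "rational_inner S" unfolding rational_inner_def ev
  proof (intro conjI ballI allI impI)
    show "(\<lambda>z. poly a z / poly b z) holomorphic_on ball 0 1"
      using * by (auto intro!: holomorphic_intros)
  next
    fix z :: complex assume "z \<in> ball 0 1"
    thus "cmod (poly a z / poly b z) \<le> 1" using * by (simp add: norm_divide divide_le_eq_1)
  next
    fix t :: complex assume t: "cmod t = 1"
    hence "poly b t \<noteq> 0" "cmod (poly a t) = cmod (poly b t)" using * by auto
    thus "cmod (poly a t / poly b t) = 1" by (simp add: norm_divide)
  qed
qed

lemma rational_inner_transfer_fun:
  assumes U: "unitary_mat (n + 1) U"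
  shows "rational_inner (transfer_fun n U)"
proof -
  have c: "U \<in> carrier_mat (n + 1) (n + 1)" using U by (simp add: unitary_mat_def)
  obtain a b where ab: "quot_of_fract (transfer_fun n U) = (a, b)" by force
  obtain y g where r: "realizes n U (b * g) y" "y 0 = a * g" and g: "g \<noteq> 0" and cop: "coprime a b"
    using transfer_fun_lowest_terms[OF c ab] by blast
  have id: "(cmod (poly g z))\<^sup>2 * ((cmod (poly b z))\<^sup>2 - (cmod (poly a z))\<^sup>2) =
      (1 - (cmod z)\<^sup>2) * (\<Sum>l<n. (cmod (poly (y (Suc l)) z))\<^sup>2)" for z
    using realizes_unitary[OF U r(1), of z]
    by (simp add: r(2) norm_mult power_mult_distrib algebra_simps)
  have Z: "finite {z. poly g z = 0}" using g by (rule poly_roots_finite)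
  have le: "cmod (poly a z) \<le> cmod (poly b z)" if "z \<in> cball 0 1" for z
  proof (rule poly_norm_le_off_finite[OF _ _ Z])
    show "connected (cball (0::complex) 1)" by simp
    show "cball (0::complex) 1 \<noteq> {x}" for x
    proof
      assume "cball (0::complex) 1 = {x}"
      thus False using uncountable_cball[of 1 "0::complex"] by simp
    qed
    fix z assume z: "z \<in> cball 0 1 - {z. poly g z = 0}"
    have "(1 - (cmod z)\<^sup>2) * (\<Sum>l<n. (cmod (poly (y (Suc l)) z))\<^sup>2) \<ge> 0"
      using z by (intro mult_nonneg_nonneg sum_nonneg) (auto simp: abs_square_le_1)
    hence "(cmod (poly a z))\<^sup>2 \<le> (cmod (poly b z))\<^sup>2"
      using z unfolding id[symmetric] by (simp add: zero_le_mult_iff)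
    thus "cmod (poly a z) \<le> cmod (poly b z)" by (rule power2_le_imp_le) simp
  qed (rule that)
  have ge: "cmod (poly b z) \<le> cmod (poly a z)" if "z \<in> sphere 0 1" for z
  proof (rule poly_norm_le_off_finite[OF _ _ Z])
    show "connected (sphere (0::complex) 1)" by (simp add: connected_sphere)
    show "sphere (0::complex) 1 \<noteq> {x}" for x
    proof
      assume e: "sphere (0::complex) 1 = {x}"
      have "{1, -1} \<subseteq> {x}" unfolding e[symmetric] by auto
      hence "(1::complex) = -1" by blast
      thus False by simp
    qed
    fix z :: complex assume z: "z \<in> sphere 0 1 - {z. poly g z = 0}"
    thus "cmod (poly b z) \<le> cmod (poly a z)" using id[of z] by simp
  qed (rule that)
  have "poly b z \<noteq> 0" if "cmod z \<le> 1" for z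
    using le[of z] that coprime_poly_0[OF cop, of z] by auto
  thus ?thesis unfolding rational_inner_iff[OF ab] using le ge by (auto intro: antisym)
qed

section \<open>Realization of inner functions by the Schur algorithm\<close>

text \<open>
  On the circle \<open>cnj t = 1 / t\<close>, so \<open>|a|\<^sup>2 = |b|\<^sup>2\<close> is an identity of Laurent polynomials; its top coefficient
  relates the outer coefficients of \<open>a\<close> and \<open>b\<close>.
\<close>

lemma extreme_coeffs_of_equal_norm:
  fixes a b :: "complex poly"
  assumes deg: "degree a \<le> n" "degree b \<le> n"
    and eq: "\<And>t. cmod t = 1 \<Longrightarrow> cmod (poly a t) = cmod (poly b t)"
  shows "coeff a n * cnj (coeff a 0) = coeff b n * cnj (coeff b 0)"
proof -
  \<comment> \<open>the polynomial \<open>z^n * cnj (q (1 / cnj z))\<close>\<close>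
  define R where "R = (\<lambda>q::complex poly. \<Sum>i\<le>n. monom (cnj (coeff q i)) (n - i))"
  have R: "poly (R q) t = t ^ n * cnj (poly q t)" if "degree q \<le> n" "cmod t = 1" for q t
  proof -
    have t: "t \<noteq> 0" "cnj t = inverse t"
      using that(2) by (auto simp: complex_norm_square divide_inverse dest: inverse_unique)
        (metis complex_cnj_cnj complex_mod_cnj complex_norm_square inverse_unique mult.commute of_real_1 one_power2)
    have "poly (R q) t = (\<Sum>i\<le>n. cnj (coeff q i) * t ^ (n - i))"
      by (simp add: R_def poly_sum poly_monom)
    also have "\<dots> = (\<Sum>i\<le>n. t ^ n * cnj (coeff q i * t ^ i))"
      using t by (intro sum.cong refl) (simp add: power_diff field_simps flip: power_mult_distrib)
    also have "\<dots> = t ^ n * cnj (\<Sum>i\<le>n. coeff q i * t ^ i)"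
      by (simp add: sum_distrib_left)
    also have "(\<Sum>i\<le>n. coeff q i * t ^ i) = poly q t"
      unfolding poly_altdef using that(1) by (intro sum.mono_neutral_right) (auto simp: coeff_eq_0)
    finally show ?thesis .
  qed
  have R0: "coeff (R q) 0 = cnj (coeff q n)" for q
  proof -
    have "coeff (R q) 0 = (\<Sum>i\<le>n. if i = n then cnj (coeff q i) else 0)"
      unfolding R_def coeff_sum by (intro sum.cong) (auto simp: coeff_monom)
    thus ?thesis by simp
  qed
  have "a * R a - b * R b = 0"
  proof (rule ccontr)
    assume "a * R a - b * R b \<noteq> 0"
    hence "finite {t. poly (a * R a - b * R b) t = 0}" by (rule poly_roots_finite)
    moreover have "sphere 0 1 \<subseteq> {t. poly (a * R a - b * R b) t = 0}"
    proof safe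
      fix t :: complex assume "t \<in> sphere 0 1"
      hence t: "cmod t = 1" by simp
      have "poly a t * cnj (poly a t) = poly b t * cnj (poly b t)"
        using eq[OF t] by (metis complex_norm_square)
      thus "poly (a * R a - b * R b) t = 0"
        using deg t by (simp add: R algebra_simps)
    qed
    ultimately have "finite (sphere (0::complex) 1)" by (rule rev_finite_subset)
    moreover have "connected (sphere (0::complex) 1)" by (simp add: connected_sphere)
    moreover have "1 \<in> sphere (0::complex) 1" "-1 \<in> sphere (0::complex) 1" by auto
    moreover have "(1::complex) \<noteq> -1" by simp
    ultimately show False
      using connected_uncountable countable_finite by blast
  qed
  hence "coeff (a * R a) 0 = coeff (b * R b) 0" by simp
  hence "cnj (coeff a 0 * cnj (coeff a n)) = cnj (coeff b 0 * cnj (coeff b n))"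
    by (simp add: coeff_mult_0 R0)
  thus ?thesis by (simp add: mult.commute)
qed

lemma poly_quotient_max_modulus:
  fixes a b :: "complex poly"
  assumes b: "\<And>z. cmod z \<le> 1 \<Longrightarrow> poly b z \<noteq> 0"
    and eq: "\<And>t. cmod t = 1 \<Longrightarrow> cmod (poly a t) = cmod (poly b t)"
  shows "cmod z \<le> 1 \<Longrightarrow> cmod (poly a z) \<le> cmod (poly b z)"
    and "cmod (poly a 0) = cmod (poly b 0) \<Longrightarrow> \<exists>c. cmod c = 1 \<and> a = [:c:] * b"
proof -
  define f where "f = (\<lambda>z. poly a z / poly b z)"
  have hol: "f holomorphic_on cball 0 1"
    unfolding f_def using b by (auto intro!: holomorphic_intros)
  have le: "cmod (f z) \<le> 1" if "cmod z \<le> 1" for z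
  proof (rule maximum_modulus_frontier[of f "cball 0 1" 1 z])
    show "f holomorphic_on interior (cball 0 1)"
      using hol interior_subset by (rule holomorphic_on_subset)
    show "continuous_on (closure (cball 0 1)) f"
      using holomorphic_on_imp_continuous_on[OF hol] by simp
  qed (use that eq b in \<open>auto simp: f_def norm_divide\<close>)
  show "cmod (poly a z) \<le> cmod (poly b z)" if "cmod z \<le> 1"
    using le[OF that] b[OF that] by (simp add: f_def norm_divide divide_le_eq_1)
  assume a0: "cmod (poly a 0) = cmod (poly b 0)"
  have "f constant_on ball 0 1"
  proof (rule maximum_modulus_principle[of f "ball 0 1" "ball 0 1" 0])
    show "f holomorphic_on ball 0 1"
      using hol ball_subset_cball by (rule holomorphic_on_subset)
    show "\<And>z. z \<in> ball 0 1 \<Longrightarrow> cmod (f z) \<le> cmod (f 0)"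
      using a0 b[of 0] le by (simp add: f_def norm_divide)
  qed auto
  then obtain c where c: "\<And>z. z \<in> ball 0 1 \<Longrightarrow> f z = c" by (auto simp: constant_on_def)
  have "a - [:c:] * b = 0"
  proof (rule ccontr)
    assume "a - [:c:] * b \<noteq> 0"
    hence "finite {t. poly (a - [:c:] * b) t = 0}" by (rule poly_roots_finite)
    moreover have "ball 0 1 \<subseteq> {t. poly (a - [:c:] * b) t = 0}"
      using c b by (auto simp: f_def field_simps)
    ultimately have "finite (ball (0::complex) 1)" by (rule rev_finite_subset)
    thus False using uncountable_ball[of 1 "0::complex"] by (simp add: countable_finite)
  qed
  hence "a = [:c:] * b" by simp
  moreover have "cmod c = 1"
    using c[of 0] a0 b[of 0] by (auto simp: f_def norm_divide)
  ultimately show "\<exists>c. cmod c = 1 \<and> a = [:c:] * b" by blast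
qed

text \<open>
  One step of the Schur algorithm in terms of numerator and denominator: if \<open>S = a / b\<close>, then
  \<open>a1 / b1 = (S - s) / (z (1 - cnj s * S))\<close>, and the degree bound drops by one.
\<close>

lemma schur_step:
  fixes a b :: "complex poly"
  assumes b: "\<And>z. cmod z \<le> 1 \<Longrightarrow> poly b z \<noteq> 0"
    and eq: "\<And>t. cmod t = 1 \<Longrightarrow> cmod (poly a t) = cmod (poly b t)"
    and deg: "degree a \<le> Suc n" "degree b \<le> Suc n"
    and s: "s = poly a 0 / poly b 0" "cmod s < 1"
  obtains a1 b1 where
    "[:0,1:] * a1 = a - [:s:] * b" "b1 = b - [:cnj s:] * a"
    "degree a1 \<le> n" "degree b1 \<le> n"
    "\<And>z. cmod z \<le> 1 \<Longrightarrow> poly b1 z \<noteq> 0"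
    "\<And>t. cmod t = 1 \<Longrightarrow> cmod (poly a1 t) = cmod (poly b1 t)"
proof -
  have b0: "coeff b 0 \<noteq> 0" using b[of 0] by (simp add: poly_0_coeff_0)
  obtain a0 a1 where a1: "a - [:s:] * b = pCons a0 a1" by (cases "a - [:s:] * b") auto
  have "poly (a - [:s:] * b) 0 = 0" using b[of 0] s(1) by simp
  hence "a0 = 0" unfolding a1 by simp
  hence a1: "[:0,1:] * a1 = a - [:s:] * b" using a1 by simp
  define b1 where "b1 = b - [:cnj s:] * a"
  have "degree (a - [:s:] * b) \<le> Suc n"
    using deg by (intro degree_diff_le) (auto intro: order.trans[OF degree_smult_le])
  hence da: "degree a1 \<le> n"
    unfolding a1[symmetric] by (auto split: if_splits)
  have db: "degree b1 \<le> n"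
  proof (rule degree_le, intro allI impI)
    fix i assume "n < i"
    \<comment> \<open>the coefficient of \<open>z^(n + 1)\<close> in \<open>b - cnj s * a\<close> cancels, as \<open>s\<close> is the quotient of the constant coefficients\<close>
    show "coeff b1 i = 0"
    proof (cases "i = Suc n")
      case True
      have "cnj (coeff b 0) * coeff b1 (Suc n) =
          coeff b (Suc n) * cnj (coeff b 0) - coeff a (Suc n) * cnj (coeff a 0)"
        using b0 by (simp add: b1_def s(1) poly_0_coeff_0 field_simps)
      also have "\<dots> = 0" using extreme_coeffs_of_equal_norm[OF deg eq] by simp
      finally show ?thesis using b0 True by simp
    next
      case False
      with \<open>n < i\<close> deg show ?thesis by (simp add: b1_def coeff_eq_0)
    qed
  qed
  have nz: "poly b1 z \<noteq> 0" if "cmod z \<le> 1" for z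
  proof
    assume "poly b1 z = 0"
    hence "cmod (poly b z) = cmod s * cmod (poly a z)"
      by (simp add: b1_def norm_mult)
    also have "\<dots> \<le> cmod s * cmod (poly b z)"
      by (intro mult_left_mono poly_quotient_max_modulus(1)[OF b eq that]) auto
    finally show False using b[OF that] s(2) by simp
  qed
  have "cmod (poly a1 t) = cmod (poly b1 t)" if t: "cmod t = 1" for t
  proof -
    define u v where "u = poly a t" and "v = poly b t"
    have uv: "u * cnj u = v * cnj v"
      using eq[OF t] unfolding u_def v_def by (metis complex_norm_square)
    have "cmod (poly a1 t) = cmod (u - s * v)"
      using arg_cong[OF a1, of "\<lambda>p. cmod (poly p t)"] t by (simp add: u_def v_def norm_mult)
    moreover have "(u - s * v) * cnj (u - s * v) = (v - cnj s * u) * cnj (v - cnj s * u)"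
      using uv by (simp add: algebra_simps) algebra
    hence "(cmod (u - s * v))\<^sup>2 = (cmod (v - cnj s * u))\<^sup>2"
      by (metis complex_norm_square of_real_eq_iff)
    hence "cmod (u - s * v) = cmod (v - cnj s * u)" by simp
    ultimately show ?thesis by (simp add: b1_def u_def v_def)
  qed
  with that[OF a1 b1_def da db nz] show ?thesis by blast
qed

lemma unimodular_constant_realization:
  fixes b :: "complex poly"
  assumes "cmod c = 1"
  shows "\<exists>U y. unitary_mat (n + 1) U \<and> realizes n U b y \<and> y 0 = [:c:] * b"
proof -
  define U where "U = mat (n + 1) (n + 1) (\<lambda>(i,j). if i = j then if i = 0 then c else 1 else 0)"
  define y where "y = (\<lambda>i::nat. if i = 0 then [:c:] * b else 0)"
  have cc: "cnj c * c = 1"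
    using assms complex_norm_square[of c] by (simp add: mult.commute)
  have "unitary_mat (n + 1) U"
    unfolding unitary_mat_iff
  proof (intro conjI allI impI)
    fix j k assume jk: "j < n + 1" "k < n + 1"
    have "(\<Sum>i<n + 1. cnj (U $$ (i,j)) * U $$ (i,k)) =
        (\<Sum>i<n + 1. if i = j then cnj (U $$ (j,j)) * U $$ (j,k) else 0)"
      using jk by (intro sum.cong) (auto simp: U_def)
    also have "\<dots> = (if j = k then 1 else 0)" using jk cc by (simp add: U_def)
    finally show "(\<Sum>i<n + 1. cnj (U $$ (i,j)) * U $$ (i,k)) = (if j = k then 1 else 0)" .
  qed (simp add: U_def)
  moreover have "realizes n U b y"
    unfolding realizes_def
  proof (intro allI impI)
    fix i assume i: "i < Suc n"
    have "(\<Sum>j<Suc n. [:U $$ (i,j):] * feed b y j) =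
        (\<Sum>j<Suc n. if j = i then [:U $$ (i,i):] * feed b y i else 0)"
      using i by (intro sum.cong) (auto simp: U_def)
    also have "\<dots> = y i" using i by (simp add: y_def feed_def U_def)
    finally show "y i = (\<Sum>j<Suc n. [:U $$ (i,j):] * feed b y j)" by simp
  qed
  moreover have "y 0 = [:c:] * b" by (simp add: y_def)
  ultimately show ?thesis by blast
qed

text \<open>
  The Schur step inverted on realizations. With \<open>\<kappa> = sqrt (1 - |s|\<^sup>2)\<close> and \<open>J = [s, \<kappa>; \<kappa>, - cnj s]\<close>, which is
  unitary, the matrix for \<open>a / b\<close> is the product of the block diagonal matrices \<open>1 \<oplus> U1\<close> and \<open>J \<oplus> I\<close>.
\<close>

lemma schur_step_realization:
  fixes a b a1 b1 :: "complex poly"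
  assumes s: "cmod s < 1"
    and ab: "[:0,1:] * a1 = a - [:s:] * b" "b1 = b - [:cnj s:] * a"
    and U1: "unitary_mat (n + 1) U1" "realizes n U1 b1 y1" "y1 0 = a1"
  shows "\<exists>U y. unitary_mat (Suc n + 1) U \<and> realizes (Suc n) U b y \<and> y 0 = a"
proof -
  define \<kappa> where "\<kappa> = complex_of_real (sqrt (1 - (cmod s)\<^sup>2))"
  have s2: "(cmod s)\<^sup>2 < 1" using s by (simp add: abs_square_less_1)
  have k: "\<kappa> * \<kappa> = 1 - s * cnj s" "cnj \<kappa> = \<kappa>" "\<kappa> \<noteq> 0"
  proof -
    show "\<kappa> * \<kappa> = 1 - s * cnj s"
    proof -
      have "\<kappa> * \<kappa> = of_real (1 - (cmod s)\<^sup>2)"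
        using s2 by (simp add: \<kappa>_def flip: of_real_mult)
      thus ?thesis by (simp only: of_real_diff complex_norm_square of_real_1)
    qed
  qed (use s2 in \<open>auto simp: \<kappa>_def\<close>)
  define r where "r = (\<lambda>j::nat. if j = 0 then s else if j = 1 then \<kappa> else 0)"
  define d where "d = (\<lambda>j::nat. if j = 0 then \<kappa> else if j = 1 then - cnj s else 1)"
  \<comment> \<open>column \<open>j\<close> is the entry \<open>r j\<close> on top of a multiple of column \<open>j - 1\<close> of \<open>U1\<close>; columns \<open>0\<close> and \<open>1\<close>
    both use column \<open>0\<close>, since \<open>0 - 1 = 0\<close>\<close>
  define U where "U = mat (Suc n + 1) (Suc n + 1)
    (\<lambda>(i,j). if i = 0 then r j else d j * U1 $$ (i - 1, j - 1))"
  have U0: "U $$ (0, j) = r j" if "j < Suc (Suc n)" for j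
    using that by (simp add: U_def)
  have US: "U $$ (Suc i, j) = d j * U1 $$ (i, j - 1)" if "i < Suc n" "j < Suc (Suc n)" for i j
    using that by (simp add: U_def)
  define y where "y = (\<lambda>i. case i of 0 \<Rightarrow> a | Suc l \<Rightarrow> [:1 / \<kappa>:] * y1 l)"
  have "unitary_mat (Suc n + 1) U"
    unfolding unitary_mat_iff
  proof (intro conjI allI impI)
    fix j k assume jk: "j < Suc n + 1" "k < Suc n + 1"
    have "(\<Sum>i<Suc n + 1. cnj (U $$ (i,j)) * U $$ (i,k)) =
        cnj (r j) * r k + cnj (d j) * d k * (\<Sum>i<Suc n. cnj (U1 $$ (i, j - 1)) * U1 $$ (i, k - 1))"
      using jk unfolding Suc_eq_plus1[symmetric] sum.lessThan_Suc_shift[of _ "Suc n"]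
      by (simp add: U0 US sum_distrib_left distrib_left mult_ac)
    also have "(\<Sum>i<Suc n. cnj (U1 $$ (i, j - 1)) * U1 $$ (i, k - 1)) =
        (if j - 1 = k - 1 then 1 else 0)"
      using U1(1) jk by (auto simp: unitary_mat_iff)
    also have "cnj (r j) * r k + cnj (d j) * d k * (if j - 1 = k - 1 then 1 else 0) =
        (if j = k then 1 else 0)"
    proof -
      have "j = 0 \<or> j = 1 \<or> j \<ge> 2" "k = 0 \<or> k = 1 \<or> k \<ge> 2" by linarith+
      thus ?thesis
        by (elim disjE) (auto simp: r_def d_def k algebra_simps)
    qed
    finally show "(\<Sum>i<Suc n + 1. cnj (U $$ (i,j)) * U $$ (i,k)) = (if j = k then 1 else 0)" .
  qed (simp add: U_def)
  moreover have "realizes (Suc n) U b y"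
    unfolding realizes_def
  proof (intro allI impI)
    fix i assume i: "i < Suc (Suc n)"
    have kk: "[:\<kappa>:] * [:1/\<kappa>:] = 1" using k(3) by (simp add: one_pCons)
    have f: "feed b y 0 = b" "feed b y (Suc 0) = [:1/\<kappa>:] * ([:0,1:] * a1)"
      "feed b y (Suc (Suc l)) = [:1/\<kappa>:] * feed b1 y1 (Suc l)" for l
      by (simp_all only: feed_def y_def nat.case U1(3) mult.left_commute[of "[:0,1:]"]
          if_True if_False nat.distinct simp_thms)
    show "y i = (\<Sum>j<Suc (Suc n). [:U $$ (i,j):] * feed b y j)"
    proof (cases i)
      case 0
      have "(\<Sum>j<Suc (Suc n). [:U $$ (0,j):] * feed b y j) =
          [:s:] * b + [:\<kappa>:] * ([:1/\<kappa>:] * ([:0,1:] * a1))"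
        unfolding sum.lessThan_Suc_shift by (simp only: U0 f) (simp add: r_def U0)
      also have "\<dots> = [:s:] * b + [:0,1:] * a1"
        using kk by (metis mult.assoc mult_1)
      also have "\<dots> = a" using ab(1) by simp
      finally show ?thesis using 0 by (simp add: y_def)
    next
      case (Suc l)
      hence l: "l < Suc n" using i by simp
      have "(\<Sum>j<Suc (Suc n). [:U $$ (i,j):] * feed b y j) =
          [:U1 $$ (l,0):] * ([:\<kappa>:] * b - [:cnj s:] * ([:1/\<kappa>:] * ([:0,1:] * a1))) +
          (\<Sum>j<n. [:U1 $$ (l, Suc j):] * ([:1/\<kappa>:] * feed b1 y1 (Suc j)))"
        unfolding sum.lessThan_Suc_shift Suc using l
        by (simp only: f) (simp add: US d_def algebra_simps)
      also have "[:\<kappa>:] * b - [:cnj s:] * ([:1/\<kappa>:] * ([:0,1:] * a1)) = [:1/\<kappa>:] * b1"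
      proof -
        have "[:\<kappa>:] = [:1/\<kappa>:] * ([:\<kappa>:] * [:\<kappa>:])" using kk by (metis mult.assoc mult.commute mult_1)
        also have "[:\<kappa>:] * [:\<kappa>:] = 1 - [:s:] * [:cnj s:]" using k(1) by (simp add: one_pCons)
        \<comment> \<open>the constant \<open>\<kappa>\<close> is to be replaced once, so that \<open>1 / \<kappa>\<close> can be factored out\<close>
        finally have K: "[:\<kappa>:] = [:1/\<kappa>:] * (1 - [:s:] * [:cnj s:])" .
        show ?thesis unfolding ab by (subst K) (simp only: algebra_simps mult_1 mult_1_right)
      qed
      also have "[:U1 $$ (l,0):] * ([:1/\<kappa>:] * b1) +
          (\<Sum>j<n. [:U1 $$ (l, Suc j):] * ([:1/\<kappa>:] * feed b1 y1 (Suc j))) =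
          [:1/\<kappa>:] * (\<Sum>j<Suc n. [:U1 $$ (l,j):] * feed b1 y1 j)"
        unfolding sum.lessThan_Suc_shift sum_distrib_left distrib_left
        by (simp only: mult.left_commute[of "[:1/\<kappa>:]"] feed_def simp_thms if_True)
      also have "(\<Sum>j<Suc n. [:U1 $$ (l,j):] * feed b1 y1 j) = y1 l"
        using U1(2) l by (simp only: realizes_def)
      finally show ?thesis using Suc by (simp add: y_def)
    qed
  qed
  moreover have "y 0 = a" by (simp add: y_def)
  ultimately show ?thesis by blast
qed

text \<open>
  No coprimality is assumed, so the bounds on the degrees alone drive the induction. The algorithm stops
  early when \<open>a / b\<close> has modulus \<open>1\<close> at \<open>0\<close>, because it is then constant.
\<close>

lemma inner_realization:
  fixes a b :: "complex poly"
  assumes "\<And>z. cmod z \<le> 1 \<Longrightarrow> poly b z \<noteq> 0"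
    and "\<And>t. cmod t = 1 \<Longrightarrow> cmod (poly a t) = cmod (poly b t)"
    and "degree a \<le> n" "degree b \<le> n"
  shows "\<exists>U y. unitary_mat (n + 1) U \<and> realizes n U b y \<and> y 0 = a"
  using assms
proof (induction n arbitrary: a b)
  case 0
  have "cmod (poly a 0) = cmod (poly b 0)"
    using 0(2)[of 1] 0(3,4) by (auto elim!: degree_eq_zeroE)
  with poly_quotient_max_modulus(2)[of b a, OF 0(1,2)]
  show ?case using unimodular_constant_realization by blast
next
  case (Suc n)
  define s where "s = poly a 0 / poly b 0"
  have "cmod (poly a 0) \<le> cmod (poly b 0)" "poly b 0 \<noteq> 0"
    using poly_quotient_max_modulus(1)[of b a 0, OF Suc(2,3)] Suc(2)[of 0] by auto
  then consider "cmod (poly a 0) = cmod (poly b 0)" | "cmod s < 1"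
    by (force simp: s_def norm_divide)
  thus ?case
  proof cases
    case 1
    with poly_quotient_max_modulus(2)[of b a, OF Suc(2,3)]
    show ?thesis using unimodular_constant_realization by blast
  next
    case 2
    obtain a1 b1 where ab: "[:0,1:] * a1 = a - [:s:] * b" "b1 = b - [:cnj s:] * a"
      and "degree a1 \<le> n" "degree b1 \<le> n"
        "\<And>z. cmod z \<le> 1 \<Longrightarrow> poly b1 z \<noteq> 0"
        "\<And>t. cmod t = 1 \<Longrightarrow> cmod (poly a1 t) = cmod (poly b1 t)"
      using schur_step[OF Suc(2-5) s_def 2] by blast
    with Suc.IH[of b1 a1] obtain U1 y1 where
      "unitary_mat (n + 1) U1" "realizes n U1 b1 y1" "y1 0 = a1" by blast
    from schur_step_realization[OF 2 ab this] show ?thesis .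
  qed
qed

lemma rational_inner_eq_transfer_fun:
  assumes S: "rational_inner S"
  obtains U where "unitary_mat (rat_degree S + 1) U" "S = transfer_fun (rat_degree S) U"
proof -
  obtain a b where ab: "quot_of_fract S = (a, b)" by force
  define n where "n = rat_degree S"
  have deg: "degree a \<le> n" "degree b \<le> n" by (simp_all add: n_def rat_degree_def ab)
  have b: "\<And>z. cmod z \<le> 1 \<Longrightarrow> poly b z \<noteq> 0"
    and eq: "\<And>t. cmod t = 1 \<Longrightarrow> cmod (poly a t) = cmod (poly b t)"
    using S by (auto simp: rational_inner_iff[OF ab])
  obtain U y where U: "unitary_mat (n + 1) U" and y: "realizes n U b y" "y 0 = a"
    using inner_realization[OF b eq deg] by blast
  have "coeff b 0 \<noteq> 0" using b[of 0] by (simp add: poly_0_coeff_0)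
  hence "transfer_fun n U = Fract a b"
    using transfer_fun_eq_Fract[OF _ y(1)] U y(2) by (simp add: unitary_mat_def)
  also have "\<dots> = S" using Fract_quot_of_fract[of S] ab by simp
  finally show thesis using that[OF U[unfolded n_def]] by (simp add: n_def)
qed

section \<open>Equivalence of realizations\<close>

text \<open>
  The inner product of the states \<open>D^j C\<close> and \<open>D^k C\<close>, antilinear in the first.
\<close>

definition krylov_gram :: "nat \<Rightarrow> complex mat \<Rightarrow> nat \<Rightarrow> nat \<Rightarrow> complex" where
  "krylov_gram n U j k = (\<Sum>l<n. cnj (orbit n U j (Suc l)) * orbit n U k (Suc l))"

text \<open>
  The vectors to which \<open>U\<close> is applied to obtain the impulse response: the unit vector \<open>e\<^sub>0\<close> at time \<open>0\<close>,
  and afterwards the impulse response one step earlier with its entry \<open>0\<close> set to zero.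
\<close>

definition orbit_input :: "nat \<Rightarrow> complex mat \<Rightarrow> nat \<Rightarrow> nat \<Rightarrow> complex" where
  "orbit_input n U k i = (case k of 0 \<Rightarrow> if i = 0 then 1 else 0
    | Suc k' \<Rightarrow> if i = 0 then 0 else orbit n U k' i)"

lemma orbit_eq_mult_input: "orbit n U k i = (\<Sum>j<n + 1. U $$ (i,j) * orbit_input n U k j)"
  unfolding Suc_eq_plus1[symmetric] sum.lessThan_Suc_shift
  by (cases k) (simp_all add: orbit_input_def)

lemma orbit_input_gram:
  "(\<Sum>i<n + 1. cnj (orbit_input n U j i) * orbit_input n U k i) = (case (j, k) of
      (0, 0) \<Rightarrow> 1 | (Suc j', Suc k') \<Rightarrow> krylov_gram n U j' k' | _ \<Rightarrow> 0)"
  unfolding Suc_eq_plus1[symmetric] sum.lessThan_Suc_shift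
  by (auto simp: orbit_input_def krylov_gram_def split: nat.split)

text \<open>
  The Gram matrix of the inputs is that of the outputs, because \<open>U\<close> is an isometry; separating the entry
  \<open>0\<close> of the outputs leaves the Gram matrix of the states.
\<close>

lemma krylov_gram_rec:
  assumes U: "unitary_mat (n + 1) U"
  shows "krylov_gram n U j k = (case (j, k) of
      (0, 0) \<Rightarrow> 1 | (Suc j', Suc k') \<Rightarrow> krylov_gram n U j' k' | _ \<Rightarrow> 0)
    - cnj (fps_nth (markov n U) j) * fps_nth (markov n U) k"
proof -
  have "(\<Sum>i<n + 1. cnj (orbit n U j i) * orbit n U k i) = (case (j, k) of
      (0, 0) \<Rightarrow> 1 | (Suc j', Suc k') \<Rightarrow> krylov_gram n U j' k' | _ \<Rightarrow> 0)"
    by (rule trans[OF unitary_mat_isometry[OF U orbit_eq_mult_input orbit_eq_mult_input] orbit_input_gram])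
  thus ?thesis
    unfolding Suc_eq_plus1[symmetric] sum.lessThan_Suc_shift
    by (simp add: markov_def krylov_gram_def algebra_simps)
qed

lemma krylov_gram_eq:
  assumes U: "unitary_mat (n + 1) U" and U': "unitary_mat (n + 1) U'"
    and F: "markov n U = markov n U'"
  shows "krylov_gram n U j k = krylov_gram n U' j k"
proof (induction j arbitrary: k)
  case 0
  show ?case
    unfolding krylov_gram_rec[OF U, of 0 k] krylov_gram_rec[OF U', of 0 k] F
    by (simp split: nat.split)
next
  case (Suc j)
  show ?case
    unfolding krylov_gram_rec[OF U, of "Suc j" k] krylov_gram_rec[OF U', of "Suc j" k] F
    by (simp add: Suc split: nat.split)
qed

text \<open>
  The matrix \<open>1 \<oplus> V\<close> of a change of basis in the state space.
\<close>

definition state_change :: "nat \<Rightarrow> complex mat \<Rightarrow> complex mat" where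
  "state_change n V = four_block_mat (1\<^sub>m 1) (0\<^sub>m 1 n) (0\<^sub>m n 1) V"

lemma state_change_carrier: "V \<in> carrier_mat n n \<Longrightarrow> state_change n V \<in> carrier_mat (n + 1) (n + 1)"
  unfolding state_change_def add.commute[of n] by (rule four_block_carrier_mat) auto

lemma state_change_mult_input:
  assumes V: "V \<in> carrier_mat n n" and i: "i < n + 1"
    and out: "\<And>k' i. k = Suc k' \<Longrightarrow> i < n + 1 \<Longrightarrow>
      orbit n U' k' i = (\<Sum>j<n + 1. state_change n V $$ (i,j) * orbit n U'' k' j)"
  shows "orbit_input n U' k i = (\<Sum>j<n + 1. state_change n V $$ (i,j) * orbit_input n U'' k j)"
proof -
  have W: "state_change n V $$ (0, 0) = 1" "l < n \<Longrightarrow> state_change n V $$ (0, Suc l) = 0"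
    "l < n \<Longrightarrow> state_change n V $$ (Suc l, 0) = 0" for l
    using V by (auto simp: state_change_def)
  show ?thesis
  proof (cases k)
    case 0
    thus ?thesis using i W
      unfolding Suc_eq_plus1[symmetric] sum.lessThan_Suc_shift
      by (cases i) (simp_all add: orbit_input_def)
  next
    case (Suc k')
    show ?thesis using i W out[OF Suc i]
      unfolding Suc_eq_plus1[symmetric] sum.lessThan_Suc_shift
      by (cases i) (simp_all add: orbit_input_def Suc)
  qed
qed

lemma equivalent_mat_markov_eq:
  assumes U: "U' \<in> carrier_mat (n + 1) (n + 1)" "U'' \<in> carrier_mat (n + 1) (n + 1)"
    and e: "equivalent_mat n U' U''"
  shows "markov n U' = markov n U''"
proof -
  obtain V where V: "V \<in> carrier_mat n n" and WU: "state_change n V * U'' = U' * state_change n V"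
    using e by (auto simp: equivalent_mat_def unitary_mat_def state_change_def Let_def)
  let ?W = "state_change n V"
  note W = state_change_carrier[OF V]
  have swap: "(\<Sum>j<n + 1. U' $$ (i,j) * ?W $$ (j,m)) = (\<Sum>j<n + 1. ?W $$ (i,j) * U'' $$ (j,m))"
    if "i < n + 1" "m < n + 1" for i m
    using WU that mult_mat_index_sum[OF W U(2), of i m] mult_mat_index_sum[OF U(1) W, of i m] by simp
  have "orbit n U' k i = (\<Sum>j<n + 1. ?W $$ (i,j) * orbit n U'' k j)" if "i < n + 1" for k i
    using that
  proof (induction k arbitrary: i rule: less_induct)
    case (less k)
    have inp: "orbit_input n U' k j = (\<Sum>m<n + 1. ?W $$ (j,m) * orbit_input n U'' k m)"
      if "j < n + 1" for j
      by (rule state_change_mult_input[OF V that less.IH]) auto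
    have "orbit n U' k i = (\<Sum>j<n + 1. U' $$ (i,j) * orbit_input n U' k j)"
      by (rule orbit_eq_mult_input)
    also have "\<dots> = (\<Sum>j<n + 1. \<Sum>m<n + 1. U' $$ (i,j) * ?W $$ (j,m) * orbit_input n U'' k m)"
      by (intro sum.cong refl) (simp only: inp lessThan_iff sum_distrib_left mult.assoc)
    also have "\<dots> = (\<Sum>m<n + 1. \<Sum>j<n + 1. U' $$ (i,j) * ?W $$ (j,m) * orbit_input n U'' k m)"
      by (rule sum.swap)
    also have "\<dots> = (\<Sum>m<n + 1. \<Sum>j<n + 1. ?W $$ (i,j) * U'' $$ (j,m) * orbit_input n U'' k m)"
      unfolding sum_distrib_right[symmetric] using swap[OF less.prems] by (intro sum.cong) auto
    also have "\<dots> = (\<Sum>j<n + 1. \<Sum>m<n + 1. ?W $$ (i,j) * U'' $$ (j,m) * orbit_input n U'' k m)"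
      by (rule sum.swap)
    also have "\<dots> = (\<Sum>j<n + 1. ?W $$ (i,j) * orbit n U'' k j)"
      unfolding orbit_eq_mult_input[of n U''] by (simp only: sum_distrib_left mult.assoc)
    finally show ?case .
  qed
  from this[of 0] have "orbit n U' k 0 = orbit n U'' k 0" for k
    using V unfolding Suc_eq_plus1[symmetric] sum.lessThan_Suc_shift
    by (simp add: state_change_def)
  thus ?thesis by (simp add: markov_def)
qed

text \<open>
  The first \<open>n + 1\<close> input vectors of the impulse response as columns; a block diagonal matrix with blocks
  \<open>1\<close> and \<open>[C  DC  \<dots>  D^(n-1) C]\<close>.
\<close>

definition input_mat :: "nat \<Rightarrow> complex mat \<Rightarrow> complex mat" where
  "input_mat n U = mat (n + 1) (n + 1) (\<lambda>(i,k). orbit_input n U k i)"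

text \<open>
  The impulse response at the times \<open>0, \<dots>, n\<close> as columns.
\<close>

definition output_mat :: "nat \<Rightarrow> complex mat \<Rightarrow> complex mat" where
  "output_mat n U = mat (n + 1) (n + 1) (\<lambda>(i,k). orbit n U k i)"

lemma input_mat_carrier: "input_mat n U \<in> carrier_mat (n + 1) (n + 1)"
  by (simp add: input_mat_def)

lemma output_mat_carrier: "output_mat n U \<in> carrier_mat (n + 1) (n + 1)"
  by (simp add: output_mat_def)

lemma mult_input_mat:
  assumes U: "U \<in> carrier_mat (n + 1) (n + 1)"
  shows "U * input_mat n U = output_mat n U"
proof (rule eq_matI)
  fix i j assume "i < dim_row (output_mat n U)" "j < dim_col (output_mat n U)"
  hence ij: "i < n + 1" "j < n + 1" by (simp_all add: output_mat_def)
  have "(U * input_mat n U) $$ (i,j) = (\<Sum>k<n + 1. U $$ (i,k) * input_mat n U $$ (k,j))"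
    by (rule mult_mat_index_sum[OF U input_mat_carrier ij])
  also have "\<dots> = (\<Sum>k<n + 1. U $$ (i,k) * orbit_input n U j k)"
    using ij by (intro sum.cong) (auto simp: input_mat_def)
  also have "\<dots> = orbit n U j i"
    by (rule orbit_eq_mult_input[symmetric])
  also have "\<dots> = output_mat n U $$ (i,j)" using ij by (simp add: output_mat_def)
  finally show "(U * input_mat n U) $$ (i,j) = output_mat n U $$ (i,j)" .
qed (use U in \<open>auto simp: input_mat_def output_mat_def\<close>)

text \<open>
  The inner products among inputs and between inputs and outputs depend on the Taylor coefficients only.
\<close>

lemma input_mat_gram:
  assumes U: "unitary_mat (n + 1) U'" "unitary_mat (n + 1) U''" and F: "markov n U' = markov n U''"
  shows "mat_adjoint (input_mat n U') * input_mat n U' = mat_adjoint (input_mat n U'') * input_mat n U''"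
    and "mat_adjoint (input_mat n U') * output_mat n U' = mat_adjoint (input_mat n U'') * output_mat n U''"
proof -
  note gram = krylov_gram_eq[OF U F]
  note Ac = mat_adjoint_carrier[OF input_mat_carrier]
  have EE: "(mat_adjoint (input_mat n U) * input_mat n U) $$ (j,k) =
      (case (j, k) of (0, 0) \<Rightarrow> 1 | (Suc j', Suc k') \<Rightarrow> krylov_gram n U j' k' | _ \<Rightarrow> 0)"
    if "j < n + 1" "k < n + 1" for U j k
  proof -
    have "(mat_adjoint (input_mat n U) * input_mat n U) $$ (j,k) =
        (\<Sum>i<n + 1. cnj (orbit_input n U j i) * orbit_input n U k i)"
      unfolding mat_adjoint_mult_index[OF input_mat_carrier input_mat_carrier that]
      using that by (intro sum.cong) (auto simp: input_mat_def)
    thus ?thesis by (simp only: orbit_input_gram)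
  qed
  show "mat_adjoint (input_mat n U') * input_mat n U' = mat_adjoint (input_mat n U'') * input_mat n U''"
  proof (rule eq_matI)
    fix j k
    assume "j < dim_row (mat_adjoint (input_mat n U'') * input_mat n U'')"
      "k < dim_col (mat_adjoint (input_mat n U'') * input_mat n U'')"
    hence "j < n + 1" "k < n + 1"
      using mult_carrier_mat[OF Ac input_mat_carrier, of n U'' U''] by auto
    thus "(mat_adjoint (input_mat n U') * input_mat n U') $$ (j,k) =
        (mat_adjoint (input_mat n U'') * input_mat n U'') $$ (j,k)"
      by (simp only: EE gram)
  qed (simp_all add: carrier_matD[OF Ac] carrier_matD[OF input_mat_carrier])
  have EY: "(mat_adjoint (input_mat n U) * output_mat n U) $$ (j,k) =
      (case j of 0 \<Rightarrow> fps_nth (markov n U) k | Suc j' \<Rightarrow> krylov_gram n U j' k)"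
    if "j < n + 1" "k < n + 1" for U j k
  proof -
    have "(mat_adjoint (input_mat n U) * output_mat n U) $$ (j,k) =
        (\<Sum>i<n + 1. cnj (orbit_input n U j i) * orbit n U k i)"
      unfolding mat_adjoint_mult_index[OF input_mat_carrier output_mat_carrier that]
      using that by (intro sum.cong) (auto simp: input_mat_def output_mat_def)
    thus ?thesis
      unfolding Suc_eq_plus1[symmetric] sum.lessThan_Suc_shift
      by (cases j) (simp_all add: orbit_input_def markov_def krylov_gram_def)
  qed
  show "mat_adjoint (input_mat n U') * output_mat n U' = mat_adjoint (input_mat n U'') * output_mat n U''"
  proof (rule eq_matI)
    fix j k
    assume "j < dim_row (mat_adjoint (input_mat n U'') * output_mat n U'')"
      "k < dim_col (mat_adjoint (input_mat n U'') * output_mat n U'')"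
    hence "j < n + 1" "k < n + 1"
      using mult_carrier_mat[OF Ac output_mat_carrier, of n U'' U''] by auto
    thus "(mat_adjoint (input_mat n U') * output_mat n U') $$ (j,k) =
        (mat_adjoint (input_mat n U'') * output_mat n U'') $$ (j,k)"
      by (simp only: EY gram F)
  qed (simp_all add: carrier_matD[OF Ac] carrier_matD[OF output_mat_carrier])
qed

lemma det_input_mat:
  "Determinant.det (input_mat n U) = Determinant.det (mat n n (\<lambda>(l,k). orbit n U k (Suc l)))"
proof -
  let ?K = "mat n n (\<lambda>(l,k). orbit n U k (Suc l))"
  have "input_mat n U = four_block_mat (1\<^sub>m 1) (0\<^sub>m 1 n) (0\<^sub>m n 1) ?K"
    by (intro eq_matI) (auto simp: input_mat_def orbit_input_def split: nat.split)
  also have "Determinant.det \<dots> = Determinant.det (1\<^sub>m 1 :: complex mat) * Determinant.det ?K"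
    by (rule det_four_block_mat_upper_right_zero) auto
  finally show ?thesis by simp
qed

lemma controllable_inverse_input_mat:
  assumes U: "U \<in> carrier_mat (n + 1) (n + 1)" and "controllable n U"
  obtains X where "X \<in> carrier_mat (n + 1) (n + 1)" "input_mat n U * X = 1\<^sub>m (n + 1)" "X * input_mat n U = 1\<^sub>m (n + 1)"
proof -
  have d: "Determinant.det (input_mat n U) \<noteq> 0"
    using assms by (simp add: controllable_iff det_input_mat)
  from det_non_zero_imp_unit[OF input_mat_carrier d, of "()"]
  show thesis using that by (auto simp: Units_def ring_mat_def)
qed

text \<open>
  The matrix \<open>W\<close> takes the input vectors of \<open>U''\<close> to those of \<open>U'\<close>. Equality of Gram matrices makes it
  unitary and shows that it takes outputs to outputs as well, whence \<open>W U'' = U' W\<close>. As it fixes \<open>e\<^sub>0\<close>, it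
  is of the form \<open>1 \<oplus> V\<close>.
\<close>

lemma markov_eq_imp_equivalent_mat:
  assumes U': "unitary_mat (n + 1) U'" and U'': "unitary_mat (n + 1) U''"
    and con: "controllable n U''" and F: "markov n U' = markov n U''"
  shows "equivalent_mat n U' U''"
proof -
  let ?N = "n + 1"
  define E' E'' Y' Y'' where E: "E' = input_mat n U'" "E'' = input_mat n U''"
    and Y: "Y' = output_mat n U'" "Y'' = output_mat n U''"
  have c: "U' \<in> carrier_mat ?N ?N" "U'' \<in> carrier_mat ?N ?N"
    using U' U'' by (simp_all add: unitary_mat_def)
  note Ec = input_mat_carrier[of n U', folded E] input_mat_carrier[of n U'', folded E]
  note Yc = output_mat_carrier[of n U', folded Y] output_mat_carrier[of n U'', folded Y]
  note gram = input_mat_gram[OF U' U'' F, folded E Y]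
  note UE = mult_input_mat[OF c(1), folded E Y] mult_input_mat[OF c(2), folded E Y]
  obtain X where X: "X \<in> carrier_mat ?N ?N" "E'' * X = 1\<^sub>m ?N" "X * E'' = 1\<^sub>m ?N"
    using controllable_inverse_input_mat[OF c(2) con] unfolding E by blast
  define W where "W = E' * X"
  have W: "W \<in> carrier_mat ?N ?N" using Ec X by (simp add: W_def)
  note adj = mat_adjoint_carrier[OF Ec(1)] mat_adjoint_carrier[OF Ec(2)]
    mat_adjoint_carrier[OF X(1)] mat_adjoint_carrier[OF W]
  have WE: "W * E'' = E'"
    unfolding W_def using assoc_mult_mat[OF Ec(1) X(1) Ec(2)] X(3) Ec(1) by simp
  have XE: "mat_adjoint X * mat_adjoint E'' = 1\<^sub>m ?N"
    using mat_adjoint_mult[OF Ec(2) X(1)] X(2) by (simp add: mat_adjoint_one)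
  have Wadj: "mat_adjoint W = mat_adjoint X * mat_adjoint E'"
    unfolding W_def by (rule mat_adjoint_mult[OF Ec(1) X(1)])
  have WW: "mat_adjoint W * W = 1\<^sub>m ?N"
  proof -
    have "mat_adjoint W * W = mat_adjoint X * (mat_adjoint E' * E') * X"
      unfolding Wadj unfolding W_def using adj Ec X(1)
      by (simp add: assoc_mult_mat[of _ ?N ?N _ ?N _ ?N])
    also have "\<dots> = (mat_adjoint X * mat_adjoint E'') * (E'' * X)"
      unfolding gram using adj Ec X(1) by (simp add: assoc_mult_mat[of _ ?N ?N _ ?N _ ?N])
    finally show ?thesis by (simp add: XE X(2))
  qed
  hence WW': "W * mat_adjoint W = 1\<^sub>m ?N" using mat_mult_left_right_inverse[OF adj(4) W] by simp
  hence Wu: "unitary_mat ?N W" using W WW by (simp add: unitary_mat_def)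
  have WY: "W * Y'' = Y'"
  proof -
    have "mat_adjoint W * Y' = mat_adjoint X * (mat_adjoint E' * Y')"
      unfolding Wadj by (rule assoc_mult_mat[OF adj(3) adj(1) Yc(1)])
    also have "\<dots> = (mat_adjoint X * mat_adjoint E'') * Y''"
      unfolding gram by (rule assoc_mult_mat[OF adj(3) adj(2) Yc(2), symmetric])
    finally have "mat_adjoint W * Y' = Y''" using XE Yc(2) by simp
    hence "W * Y'' = (W * mat_adjoint W) * Y'" using assoc_mult_mat[OF W adj(4) Yc(1)] by simp
    thus ?thesis using WW' Yc(1) by simp
  qed
  have "W * U'' = W * U'' * (E'' * X)" using W c(2) X(2) by simp
  also have "\<dots> = W * (U'' * E'') * X"
    using W c(2) Ec(2) X(1) by (simp add: assoc_mult_mat[of _ ?N ?N _ ?N _ ?N])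
  also have "\<dots> = U' * (W * E'') * X" by (simp add: UE WE WY)
  also have "\<dots> = U' * W * (E'' * X)"
    using W c(1) Ec(2) X(1) by (simp add: assoc_mult_mat[of _ ?N ?N _ ?N _ ?N])
  also have "\<dots> = U' * W" using W c(1) X(2) by simp
  finally have WU: "W * U'' = U' * W" .
  have col: "W $$ (i, 0) = (if i = 0 then 1 else 0)" if "i < ?N" for i
  proof -
    have "E' $$ (i, 0) = (\<Sum>k<?N. W $$ (i,k) * E'' $$ (k, 0))"
      using mult_mat_index_sum[OF W Ec(2) that, of 0] WE by simp
    also have "\<dots> = (\<Sum>k<?N. if k = 0 then W $$ (i,0) else 0)"
      by (intro sum.cong) (auto simp: E input_mat_def orbit_input_def)
    finally show ?thesis using that by (simp add: E input_mat_def orbit_input_def)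
  qed
  have orth: "(\<Sum>i<?N. cnj (W $$ (i,j)) * W $$ (i,k)) = (if j = k then 1 else 0)"
    if "j < ?N" "k < ?N" for j k
    using Wu that unfolding unitary_mat_iff by blast
  \<comment> \<open>the columns of \<open>W\<close> are orthonormal, and column \<open>0\<close> is \<open>e\<^sub>0\<close>\<close>
  have row: "W $$ (0, k) = (if k = 0 then 1 else 0)" if "k < ?N" for k
  proof -
    have "W $$ (0,k) = (\<Sum>i<?N. if i = 0 then W $$ (0,k) else 0)"
      by (simp del: sum.lessThan_Suc)
    also have "\<dots> = (\<Sum>i<?N. cnj (W $$ (i,0)) * W $$ (i,k))"
      by (intro sum.cong) (auto simp: col)
    also have "\<dots> = (if 0 = k then 1 else 0)" by (rule orth) (use that in auto)
    finally show ?thesis by auto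
  qed
  define V where "V = mat n n (\<lambda>(i,j). W $$ (Suc i, Suc j))"
  have WV: "W = four_block_mat (1\<^sub>m 1) (0\<^sub>m 1 n) (0\<^sub>m n 1) V"
    using W by (intro eq_matI) (auto simp: V_def row col)
  have "unitary_mat n V"
    unfolding unitary_mat_iff
  proof (intro conjI allI impI)
    fix j k assume jk: "j < n" "k < n"
    thus "(\<Sum>i<n. cnj (V $$ (i,j)) * V $$ (i,k)) = (if j = k then 1 else 0)"
      using orth[of "Suc j" "Suc k"] row[of "Suc j"]
      unfolding Suc_eq_plus1[symmetric] sum.lessThan_Suc_shift by (simp add: V_def)
  qed (simp add: V_def)
  thus ?thesis unfolding equivalent_mat_def Let_def using WU unfolding WV by blast
qed

theorem theorem3p10:
  fixes n :: nat
  shows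
    "(\<forall>S. rational_inner S \<and> rat_degree S = n \<longrightarrow>
        (\<exists>U. unitary_mat (n + 1) U \<and> minimal_mat n U \<and> S = transfer_fun n U))
   \<and> (\<forall>U. unitary_mat (n + 1) U \<longrightarrow>
        rational_inner (transfer_fun n U) \<and> rat_degree (transfer_fun n U) \<le> n \<and>
        (minimal_mat n U \<longrightarrow> rat_degree (transfer_fun n U) = n))
   \<and> (\<forall>U' U''. unitary_mat (n + 1) U' \<and> unitary_mat (n + 1) U'' \<longrightarrow>
        (equivalent_mat n U' U'' \<longrightarrow> transfer_fun n U' = transfer_fun n U'') \<and>
        (transfer_fun n U' = transfer_fun n U'' \<and> minimal_mat n U' \<and> minimal_mat n U'' \<longrightarrow>
           equivalent_mat n U' U''))"
proof (intro conjI allI impI; (elim conjE)?)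
  fix S assume "rational_inner S" "rat_degree S = n"
  then obtain U where U: "unitary_mat (n + 1) U" "S = transfer_fun n U"
    using rational_inner_eq_transfer_fun by metis
  moreover have "minimal_mat n U"
    using U \<open>rat_degree S = n\<close> rat_degree_transfer_fun_eq_iff by (simp add: unitary_mat_def)
  ultimately show "\<exists>U. unitary_mat (n + 1) U \<and> minimal_mat n U \<and> S = transfer_fun n U" by blast
next
  fix U assume U: "unitary_mat (n + 1) U"
  show "rational_inner (transfer_fun n U)" using U by (rule rational_inner_transfer_fun)
  show "rat_degree (transfer_fun n U) \<le> n"
    using U by (intro rat_degree_transfer_fun_le) (simp add: unitary_mat_def)
  show "rat_degree (transfer_fun n U) = n" if "minimal_mat n U"
    using U that rat_degree_transfer_fun_eq_iff by (simp add: unitary_mat_def)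
next
  fix U' U'' assume U: "unitary_mat (n + 1) U'" "unitary_mat (n + 1) U''"
  hence c: "U' \<in> carrier_mat (n + 1) (n + 1)" "U'' \<in> carrier_mat (n + 1) (n + 1)"
    by (simp_all add: unitary_mat_def)
  show "transfer_fun n U' = transfer_fun n U''" if "equivalent_mat n U' U''"
    using equivalent_mat_markov_eq[OF c that] by (simp add: transfer_fun_eq_iff_markov[OF c])
  show "equivalent_mat n U' U''" if "transfer_fun n U' = transfer_fun n U''" "minimal_mat n U''"
    using markov_eq_imp_equivalent_mat[OF U] that
    by (simp add: transfer_fun_eq_iff_markov[OF c] minimal_mat_def)
qed

end
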